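(* Let $\lambda_1,\dots,\lambda_6\in\mathbb{R}$ and let $G$ be a connected real Lie group of dimension $6$ with a global basis $\{X_1,\dots,X_6\}$ of left invariant vector fields whose Lie brackets are $$\begin{aligned} &[X_2,X_3]=\lambda_1X_5+\lambda_2X_6, && [X_3,X_1]=\lambda_4X_4+\lambda_3X_6, && [X_1,X_2]=\lambda_5X_4+\lambda_6X_5,\\ &[X_5,X_6]=-\lambda_4X_2-\lambda_5X_3, && [X_6,X_4]=-\lambda_1X_1-\lambda_6X_3, && [X_4,X_5]=-\lambda_2X_1-\lambda_3X_2,\\ &[X_1,X_5]=\lambda_6X_2-\lambda_2X_4, && [X_1,X_6]=-\lambda_3X_3+\lambda_1X_4, && [X_2,X_4]=-\lambda_5X_1+\lambda_3X_5,\\ &[X_2,X_6]=\lambda_2X_3-\lambda_4X_5, && [X_3,X_4]=\lambda_4X_1-\lambda_6X_6, && [X_3,X_5]=-\lambda_1X_2+\lambda_5X_6, \end{aligned}$$ $$\begin{aligned} &[X_1,X_4]=\lambda_5X_2-\lambda_4X_3+\lambda_2X_5-\lambda_1X_6,\\ &[X_2,X_5]=-\lambda_6X_1+\lambda_1X_3-\lambda_3X_4+\lambda_4X_6,\\ &[X_3,X_6]=\lambda_3X_1-\lambda_2X_2+\lambda_6X_4-\lambda_5X_5. \end{aligned}$$ Let $J$ be the left invariant almost complex structure on $G$ given by $JX_i=X_{3+i}$, $JX_{3+i}=-X_i$ for $i\in\{1,2,3\}$, and let $g$ be the left invariant metric given by $g(X_i,X_i)=-g(X_{3+i},X_{3+i})=1$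 for $i\in\{1,2,3\}$ and $g(X_j,X_k)=0$ for $j\neq k$ in $\{1,\dots,6\}$. Then the manifold $(G,J,g)$: (i) is isotropic K\"ahlerian, i.e. $\|\nabla J\|^2=0$; (ii) has an isotropic Nijenhuis tensor, i.e. $\|N\|^2=0$; (iii) is scalar flat, i.e. its scalar curvature satisfies $\tau=0$; (iv) is locally symmetric, i.e. $\nabla R=0$.
   Context: Let $\nabla$ be the Levi-Civita connection of $g$, let $\{e_i\}$ be a basis of a tangent space, and let $g^{ij}$ be the components of the inverse matrix of $g$ in this basis; repeated indices are summed. - Square norm of $\nabla J$: $\|\nabla J\|^2=g^{ij}g^{kl}\,g\bigl((\nabla_{e_i}J)e_k,(\nabla_{e_j}J)e_l\bigr)$. The manifold is called isotropic K\"ahlerian if $\|\nabla J\|^2=0$. - Nijenhuis tensor: $N(X,Y)=[X,Y]+J[JX,Y]+J[X,JY]-[JX,JY]$, with square norm $\|N\|^2=g^{ik}g^{js}\,g\bigl(N(e_i,e_j),N(e_k,e_s)\bigr)$. It is called isotropic if $\|N\|^2=0$. - Curvature: $R(X,Y)Z=\nabla_X\nabla_YZ-\nabla_Y\nabla_XZ-\nabla_{[X,Y]}Z$, $R(X,Y,Z,U)=g(R(X,Y)Z,U)$, Ricci tensor $\rho(y,z)=g^{ij}R(e_i,y,z,e_j)$, scalar curvature $\tau=g^{ij}\rho(e_i,e_j)$. *)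

theory Defs
  imports "HOL-Analysis.Analysis" "HOL-Library.Function_Algebras"
begin

text \<open>
  Tangent vectors are real-valued functionals on functions, so the pointwise vector space
  structure on function types supplies linear combinations, \<open>span\<close> and \<open>independent\<close> for them.
\<close>

instantiation "fun" :: (type, real_vector) real_vector
begin

definition scaleR_fun :: "real \<Rightarrow> ('a \<Rightarrow> 'b) \<Rightarrow> 'a \<Rightarrow> 'b" where
  "scaleR_fun c f = (\<lambda>x. c *\<^sub>R f x)"

instance
  by standard (simp_all add: scaleR_fun_def fun_eq_iff scaleR_add_right scaleR_add_left)

end

text \<open>
  For an open subset \<open>S\<close> of a Euclidean space, \<open>Ck_on k S f\<close> says that \<open>f\<close> is of class C^k on \<open>S\<close>:
  all iterated directional derivatives of order up to \<open>k\<close> exist and are continuous.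
\<close>

primrec Ck_on :: "nat \<Rightarrow> 'a::euclidean_space set \<Rightarrow> ('a \<Rightarrow> 'b::real_normed_vector) \<Rightarrow> bool" where
  "Ck_on 0 S f \<longleftrightarrow> continuous_on S f"
| "Ck_on (Suc k) S f \<longleftrightarrow>
     f differentiable_on S \<and> (\<forall>v. Ck_on k S (\<lambda>x. frechet_derivative f (at x) v))"

definition smooth_on :: "'a::euclidean_space set \<Rightarrow> ('a \<Rightarrow> 'b::real_normed_vector) \<Rightarrow> bool" where
  "smooth_on S f \<longleftrightarrow> (\<forall>k. Ck_on k S f)"

text \<open>
  The underlying set of a manifold is a whole type \<open>'m\<close>, and a smooth structure is given by an atlas,
  a set of charts (domain, coordinate map). Only the values of a coordinate map on the domain matter.
\<close>

type_synonym ('m, 'e) atlas = "('m set \<times> ('m \<Rightarrow> 'e)) set"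

definition smooth_manifold ::
  "('m::{t2_space, second_countable_topology}, 'e::euclidean_space) atlas \<Rightarrow> bool" where
  "smooth_manifold A \<longleftrightarrow>
     (\<Union>(U, \<phi>)\<in>A. U) = UNIV \<and>
     (\<forall>(U, \<phi>)\<in>A. open U \<and> open (\<phi> ` U) \<and> homeomorphism U (\<phi> ` U) \<phi> (inv_into U \<phi>)) \<and>
     (\<forall>(U, \<phi>)\<in>A. \<forall>(V, \<psi>)\<in>A. smooth_on (\<phi> ` (U \<inter> V)) (\<psi> \<circ> inv_into U \<phi>))"

definition smooth_functions :: "('m, 'e::euclidean_space) atlas \<Rightarrow> ('m \<Rightarrow> real) set" where
  "smooth_functions A = {f. \<forall>(U, \<phi>)\<in>A. smooth_on (\<phi> ` U) (f \<circ> inv_into U \<phi>)}"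

definition smooth_map ::
  "('m::topological_space, 'e::euclidean_space) atlas \<Rightarrow>
   ('n::topological_space, 'f::euclidean_space) atlas \<Rightarrow> ('m \<Rightarrow> 'n) \<Rightarrow> bool" where
  "smooth_map A B F \<longleftrightarrow> continuous_on UNIV F \<and>
     (\<forall>(U, \<phi>)\<in>A. \<forall>(V, \<psi>)\<in>B. smooth_on (\<phi> ` (U \<inter> F -` V)) (\<psi> \<circ> F \<circ> inv_into U \<phi>))"

definition product_atlas ::
  "('m, 'e) atlas \<Rightarrow> ('n, 'f) atlas \<Rightarrow> ('m \<times> 'n, 'e \<times> 'f) atlas" where
  "product_atlas A B = {(U \<times> V, map_prod \<phi> \<psi>) | U \<phi> V \<psi>. (U, \<phi>) \<in> A \<and> (V, \<psi>) \<in> B}"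

definition lie_group ::
  "('m::{t2_space, second_countable_topology}, 'e::euclidean_space) atlas \<Rightarrow>
   ('m \<Rightarrow> 'm \<Rightarrow> 'm) \<Rightarrow> 'm \<Rightarrow> ('m \<Rightarrow> 'm) \<Rightarrow> bool" where
  "lie_group A mul e iv \<longleftrightarrow>
     smooth_manifold A \<and> group mul e iv \<and>
     smooth_map (product_atlas A A) A (\<lambda>(x, y). mul x y) \<and> smooth_map A A iv"

text \<open>
  Tangent vectors at \<open>p\<close> are the derivations at \<open>p\<close> of the algebra of smooth functions. They are
  required to vanish on non-smooth functions, so that two tangent vectors are equal as functionals
  iff they agree on all smooth functions.
\<close>

type_synonym 'm tangent_vector = "('m \<Rightarrow> real) \<Rightarrow> real"
type_synonym 'm vector_field = "'m \<Rightarrow> 'm tangent_vector"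

definition tangent_space :: "('m, 'e::euclidean_space) atlas \<Rightarrow> 'm \<Rightarrow> 'm tangent_vector set" where
  "tangent_space A p = {v.
     (\<forall>f\<in>smooth_functions A. \<forall>h\<in>smooth_functions A. v (\<lambda>x. f x + h x) = v f + v h) \<and>
     (\<forall>c. \<forall>f\<in>smooth_functions A. v (\<lambda>x. c * f x) = c * v f) \<and>
     (\<forall>f\<in>smooth_functions A. \<forall>h\<in>smooth_functions A. v (\<lambda>x. f x * h x) = f p * v h + h p * v f) \<and>
     (\<forall>f. f \<notin> smooth_functions A \<longrightarrow> v f = 0)}"

definition tangent_basis ::
  "('m, 'e::euclidean_space) atlas \<Rightarrow> 'm \<Rightarrow> ('i \<Rightarrow> 'm tangent_vector) \<Rightarrow> bool" where
  "tangent_basis A p e \<longleftrightarrow>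
     inj e \<and> independent (range e) \<and> span (range e) = tangent_space A p"

definition vector_fields :: "('m, 'e::euclidean_space) atlas \<Rightarrow> 'm vector_field set" where
  "vector_fields A = {X. (\<forall>p. X p \<in> tangent_space A p) \<and>
     (\<forall>f\<in>smooth_functions A. (\<lambda>p. X p f) \<in> smooth_functions A)}"

definition lie_bracket :: "'m vector_field \<Rightarrow> 'm vector_field \<Rightarrow> 'm vector_field" where
  "lie_bracket X Y = (\<lambda>p f. X p (\<lambda>q. Y q f) - Y p (\<lambda>q. X q f))"

definition global_frame ::
  "('m, 'e::euclidean_space) atlas \<Rightarrow> ('i \<Rightarrow> 'm vector_field) \<Rightarrow> bool" where
  "global_frame A X \<longleftrightarrow> (\<forall>i. X i \<in> vector_fields A) \<and> (\<forall>p. tangent_basis A p (\<lambda>i. X i p))"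

text \<open>The differential of \<open>F\<close>: on derivations it is precomposition with \<open>f \<mapsto> f \<circ> F\<close>.\<close>

definition push_forward ::
  "('m, 'e::euclidean_space) atlas \<Rightarrow> ('m \<Rightarrow> 'm) \<Rightarrow> 'm tangent_vector \<Rightarrow> 'm tangent_vector" where
  "push_forward A F v = (\<lambda>f. if f \<in> smooth_functions A then v (f \<circ> F) else 0)"

definition left_invariant_field ::
  "('m, 'e::euclidean_space) atlas \<Rightarrow> ('m \<Rightarrow> 'm \<Rightarrow> 'm) \<Rightarrow> 'm vector_field \<Rightarrow> bool" where
  "left_invariant_field A mul X \<longleftrightarrow> (\<forall>a p. push_forward A (mul a) (X p) = X (mul a p))"

type_synonym 'm endomorphism_field = "'m \<Rightarrow> 'm tangent_vector \<Rightarrow> 'm tangent_vector"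
type_synonym 'm metric = "'m \<Rightarrow> 'm tangent_vector \<Rightarrow> 'm tangent_vector \<Rightarrow> real"
type_synonym 'm connection = "'m vector_field \<Rightarrow> 'm vector_field \<Rightarrow> 'm vector_field"

definition apply_field :: "'m endomorphism_field \<Rightarrow> 'm vector_field \<Rightarrow> 'm vector_field" where
  "apply_field J X = (\<lambda>p. J p (X p))"

definition almost_complex_structure ::
  "('m, 'e::euclidean_space) atlas \<Rightarrow> 'm endomorphism_field \<Rightarrow> bool" where
  "almost_complex_structure A J \<longleftrightarrow>
     (\<forall>p. \<forall>v\<in>tangent_space A p. J p v \<in> tangent_space A p \<and> J p (J p v) = - v) \<and>
     (\<forall>p. \<forall>v\<in>tangent_space A p. \<forall>w\<in>tangent_space A p. J p (v + w) = J p v + J p w) \<and>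
     (\<forall>p c. \<forall>v\<in>tangent_space A p. J p (c *\<^sub>R v) = c *\<^sub>R J p v) \<and>
     (\<forall>X\<in>vector_fields A. apply_field J X \<in> vector_fields A)"

definition left_invariant_endomorphism ::
  "('m, 'e::euclidean_space) atlas \<Rightarrow> ('m \<Rightarrow> 'm \<Rightarrow> 'm) \<Rightarrow> 'm endomorphism_field \<Rightarrow> bool" where
  "left_invariant_endomorphism A mul J \<longleftrightarrow>
     (\<forall>a p. \<forall>v\<in>tangent_space A p.
        J (mul a p) (push_forward A (mul a) v) = push_forward A (mul a) (J p v))"

definition pseudo_riemannian_metric ::
  "('m, 'e::euclidean_space) atlas \<Rightarrow> 'm metric \<Rightarrow> bool" where
  "pseudo_riemannian_metric A g \<longleftrightarrow>
     (\<forall>p. \<forall>u\<in>tangent_space A p. \<forall>v\<in>tangent_space A p. \<forall>w\<in>tangent_space A p.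
        g p (u + v) w = g p u w + g p v w) \<and>
     (\<forall>p c. \<forall>v\<in>tangent_space A p. \<forall>w\<in>tangent_space A p. g p (c *\<^sub>R v) w = c * g p v w) \<and>
     (\<forall>p. \<forall>v\<in>tangent_space A p. \<forall>w\<in>tangent_space A p. g p v w = g p w v) \<and>
     (\<forall>p. \<forall>v\<in>tangent_space A p. (\<forall>w\<in>tangent_space A p. g p v w = 0) \<longrightarrow> v = 0) \<and>
     (\<forall>X\<in>vector_fields A. \<forall>Y\<in>vector_fields A. (\<lambda>p. g p (X p) (Y p)) \<in> smooth_functions A)"

definition left_invariant_metric ::
  "('m, 'e::euclidean_space) atlas \<Rightarrow> ('m \<Rightarrow> 'm \<Rightarrow> 'm) \<Rightarrow> 'm metric \<Rightarrow> bool" where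
  "left_invariant_metric A mul g \<longleftrightarrow>
     (\<forall>a p. \<forall>v\<in>tangent_space A p. \<forall>w\<in>tangent_space A p.
        g (mul a p) (push_forward A (mul a) v) (push_forward A (mul a) w) = g p v w)"

definition affine_connection ::
  "('m, 'e::euclidean_space) atlas \<Rightarrow> 'm connection \<Rightarrow> bool" where
  "affine_connection A D \<longleftrightarrow>
     (\<forall>X\<in>vector_fields A. \<forall>Y\<in>vector_fields A. D X Y \<in> vector_fields A) \<and>
     (\<forall>X\<in>vector_fields A. \<forall>Y\<in>vector_fields A. \<forall>Z\<in>vector_fields A.
        D (X + Y) Z = D X Z + D Y Z \<and> D X (Y + Z) = D X Y + D X Z) \<and>
     (\<forall>f\<in>smooth_functions A. \<forall>X\<in>vector_fields A. \<forall>Y\<in>vector_fields A.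
        D (\<lambda>p. f p *\<^sub>R X p) Y = (\<lambda>p. f p *\<^sub>R D X Y p) \<and>
        D X (\<lambda>p. f p *\<^sub>R Y p) = (\<lambda>p. X p f *\<^sub>R Y p + f p *\<^sub>R D X Y p))"

definition levi_civita_connection ::
  "('m, 'e::euclidean_space) atlas \<Rightarrow> 'm metric \<Rightarrow> 'm connection \<Rightarrow> bool" where
  "levi_civita_connection A g D \<longleftrightarrow>
     affine_connection A D \<and>
     (\<forall>X\<in>vector_fields A. \<forall>Y\<in>vector_fields A. D X Y - D Y X = lie_bracket X Y) \<and>
     (\<forall>X\<in>vector_fields A. \<forall>Y\<in>vector_fields A. \<forall>Z\<in>vector_fields A. \<forall>p.
        X p (\<lambda>q. g q (Y q) (Z q)) = g p (D X Y p) (Z p) + g p (Y p) (D X Z p))"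

definition deriv_endomorphism ::
  "'m connection \<Rightarrow> 'm endomorphism_field \<Rightarrow> 'm vector_field \<Rightarrow> 'm vector_field \<Rightarrow> 'm vector_field" where
  "deriv_endomorphism D J X Y = D X (apply_field J Y) - apply_field J (D X Y)"

definition nijenhuis ::
  "'m endomorphism_field \<Rightarrow> 'm vector_field \<Rightarrow> 'm vector_field \<Rightarrow> 'm vector_field" where
  "nijenhuis J X Y =
     lie_bracket X Y
     + apply_field J (lie_bracket (apply_field J X) Y)
     + apply_field J (lie_bracket X (apply_field J Y))
     - lie_bracket (apply_field J X) (apply_field J Y)"

definition curvature ::
  "'m connection \<Rightarrow> 'm vector_field \<Rightarrow> 'm vector_field \<Rightarrow> 'm vector_field \<Rightarrow> 'm vector_field" where
  "curvature D X Y Z = D X (D Y Z) - D Y (D X Z) - D (lie_bracket X Y) Z"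

definition curvature4 ::
  "'m metric \<Rightarrow> 'm connection \<Rightarrow> 'm vector_field \<Rightarrow> 'm vector_field \<Rightarrow> 'm vector_field \<Rightarrow>
   'm vector_field \<Rightarrow> 'm \<Rightarrow> real" where
  "curvature4 g D X Y Z U p = g p (curvature D X Y Z p) (U p)"

definition deriv_curvature ::
  "'m connection \<Rightarrow> 'm vector_field \<Rightarrow> 'm vector_field \<Rightarrow> 'm vector_field \<Rightarrow> 'm vector_field \<Rightarrow>
   'm vector_field" where
  "deriv_curvature D W X Y Z =
     D W (curvature D X Y Z) - curvature D (D W X) Y Z - curvature D X (D W Y) Z
     - curvature D X Y (D W Z)"

text \<open>
  A basis of the tangent space at \<open>p\<close> is presented by vector fields \<open>E i\<close> whose values at \<open>p\<close> form
  that basis; away from \<open>p\<close> the fields \<open>E i\<close> are arbitrary. Each tensor field contracted below,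
  evaluated at \<open>p\<close>, depends only on the values of its vector field arguments at \<open>p\<close>.
\<close>

definition basis_fields_at ::
  "('m, real^'n) atlas \<Rightarrow> 'm \<Rightarrow> ('n \<Rightarrow> 'm vector_field) \<Rightarrow> bool" where
  "basis_fields_at A p E \<longleftrightarrow> (\<forall>i. E i \<in> vector_fields A) \<and> tangent_basis A p (\<lambda>i. E i p)"

definition inverse_gram ::
  "'m metric \<Rightarrow> ('n::finite \<Rightarrow> 'm vector_field) \<Rightarrow> 'm \<Rightarrow> real^'n^'n" where
  "inverse_gram g E p = matrix_inv (\<chi> i j. g p (E i p) (E j p))"

definition nabla_J_square_norm ::
  "'m metric \<Rightarrow> 'm connection \<Rightarrow> 'm endomorphism_field \<Rightarrow> ('n::finite \<Rightarrow> 'm vector_field) \<Rightarrow>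
   'm \<Rightarrow> real" where
  "nabla_J_square_norm g D J E p =
     (\<Sum>i\<in>UNIV. \<Sum>j\<in>UNIV. \<Sum>k\<in>UNIV. \<Sum>l\<in>UNIV.
        inverse_gram g E p $ i $ j * inverse_gram g E p $ k $ l *
        g p (deriv_endomorphism D J (E i) (E k) p) (deriv_endomorphism D J (E j) (E l) p))"

definition nijenhuis_square_norm ::
  "'m metric \<Rightarrow> 'm endomorphism_field \<Rightarrow> ('n::finite \<Rightarrow> 'm vector_field) \<Rightarrow> 'm \<Rightarrow> real" where
  "nijenhuis_square_norm g J E p =
     (\<Sum>i\<in>UNIV. \<Sum>j\<in>UNIV. \<Sum>k\<in>UNIV. \<Sum>s\<in>UNIV.
        inverse_gram g E p $ i $ k * inverse_gram g E p $ j $ s *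
        g p (nijenhuis J (E i) (E j) p) (nijenhuis J (E k) (E s) p))"

definition ricci ::
  "'m metric \<Rightarrow> 'm connection \<Rightarrow> ('n::finite \<Rightarrow> 'm vector_field) \<Rightarrow>
   'm vector_field \<Rightarrow> 'm vector_field \<Rightarrow> 'm \<Rightarrow> real" where
  "ricci g D E Y Z p =
     (\<Sum>i\<in>UNIV. \<Sum>j\<in>UNIV. inverse_gram g E p $ i $ j * curvature4 g D (E i) Y Z (E j) p)"

definition scalar_curvature ::
  "'m metric \<Rightarrow> 'm connection \<Rightarrow> ('n::finite \<Rightarrow> 'm vector_field) \<Rightarrow> 'm \<Rightarrow> real" where
  "scalar_curvature g D E p =
     (\<Sum>i\<in>UNIV. \<Sum>j\<in>UNIV. inverse_gram g E p $ i $ j * ricci g D E (E i) (E j) p)"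

definition isotropic_kaehlerian ::
  "('m, real^'n::finite) atlas \<Rightarrow> 'm endomorphism_field \<Rightarrow> 'm metric \<Rightarrow> 'm connection \<Rightarrow> bool" where
  "isotropic_kaehlerian A J g D \<longleftrightarrow>
     (\<forall>p E. basis_fields_at A p E \<longrightarrow> nabla_J_square_norm g D J E p = 0)"

definition isotropic_nijenhuis ::
  "('m, real^'n::finite) atlas \<Rightarrow> 'm endomorphism_field \<Rightarrow> 'm metric \<Rightarrow> bool" where
  "isotropic_nijenhuis A J g \<longleftrightarrow>
     (\<forall>p E. basis_fields_at A p E \<longrightarrow> nijenhuis_square_norm g J E p = 0)"

definition scalar_flat ::
  "('m, real^'n::finite) atlas \<Rightarrow> 'm metric \<Rightarrow> 'm connection \<Rightarrow> bool" where
  "scalar_flat A g D \<longleftrightarrow>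
     (\<forall>p E. basis_fields_at A p E \<longrightarrow> scalar_curvature g D E p = 0)"

definition locally_symmetric ::
  "('m, 'e::euclidean_space) atlas \<Rightarrow> 'm connection \<Rightarrow> bool" where
  "locally_symmetric A D \<longleftrightarrow>
     (\<forall>W\<in>vector_fields A. \<forall>X\<in>vector_fields A. \<forall>Y\<in>vector_fields A. \<forall>Z\<in>vector_fields A.
        deriv_curvature D W X Y Z = 0)"

end

theory Submission
  imports Defs
begin

text \<open>
  On the frame \<open>X\<close> the metric is ad-invariant: \<open>g([X\<^sub>i, X\<^sub>j], X\<^sub>k)\<close> is invariant under cyclic
  permutation. Koszul's formula then gives \<open>\<nabla>\<^sub>Y Z = [Y, Z] / 2\<close> and hence
  \<open>R(U, V)W = - [[U, V], W] / 4\<close> on constant combinations of the frame, so \<open>\<nabla>R = 0\<close> there is the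
  Jacobi identity, and tensoriality extends it to all vector fields. Each of the three scalars is a
  metric contraction of a tensor, hence independent of the basis; evaluated in the frame it is a
  quadratic form in the structure constants, which vanishes identically in the parameters \<open>\<lambda>\<^sub>i\<close>.
\<close>

section \<open>Algebras of smooth functions\<close>

text \<open>The tensors act on globally defined fields, whereas the three scalars use fields
  \<open>E i\<close> prescribed only at one point. Since the frame is global and smooth fields have
  smooth coordinates in it, linearity over the smooth functions by itself forces pointwise
  dependence, without cut-off functions. Why the quadratic forms vanish: by ad-invariance
  \<open>T(i,j,k) = g([X i, X j], X k)\<close> is totally skew. It is nonzero only on triples made
  of a pair {i, i+3} and a further index, and each parameter sits, up to sign, on one such triple
  and on the complementary one. The six signs of the metric multiply to -1, so complementary triples
  have opposite sign products, and in the signed sum of the squares of \<open>T\<close> every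
  parameter cancels against itself. In the mixed terms of the other two sums, after reindexing,
  \<open>T\<close> is multiplied by its value with \<open>J\<close> applied in two slots. Such a
  product survives only if these slots hold the pair {i, i+3}, since otherwise an index is repeated;
  it is then the square of \<open>T\<close>, so the same cancellation applies.\<close>

lemma Ck_on_cong:
  assumes "open S" "\<And>x. x \<in> S \<Longrightarrow> f x = g x" "Ck_on k S f"
  shows "Ck_on k S g"
  using assms(2,3)
proof (induction k arbitrary: f g)
  case 0
  then show ?case by (simp cong: continuous_on_cong)
next
  case (Suc k)
  have diff: "f differentiable at x" if "x \<in> S" for x
    using Suc.prems(2) that assms(1) by (auto simp: differentiable_on_eq_differentiable_at)
  have "frechet_derivative f (at x) v = frechet_derivative g (at x) v" if "x \<in> S" for x v
    using frechet_derivative_transform_within_open[OF diff[OF that] assms(1) that Suc.prems(1)] by simp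
  moreover have "g differentiable_on S"
    unfolding differentiable_on_eq_differentiable_at[OF assms(1)]
    using diff Suc.prems(1) assms(1) has_derivative_transform_within_open
    by (metis differentiable_def)
  ultimately show ?case
    using Suc.prems(2) by (auto intro: Suc.IH[rotated])
qed

lemma Ck_on_Suc_imp: "Ck_on (Suc k) S f \<Longrightarrow> Ck_on k S f"
  by (induction k arbitrary: f) (auto intro: differentiable_imp_continuous_on)

lemma Ck_on_const: "Ck_on k S (\<lambda>x. c)"
  by (induction k arbitrary: c) auto

lemma Ck_on_add:
  assumes "open S" "Ck_on k S f" "Ck_on k S g"
  shows "Ck_on k S (\<lambda>x. f x + g x)"
  using assms(2,3)
proof (induction k arbitrary: f g)
  case 0
  then show ?case by (simp add: continuous_on_add)
next
  case (Suc k)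
  have fd: "(f has_derivative frechet_derivative f (at x)) (at x)"
    and gd: "(g has_derivative frechet_derivative g (at x)) (at x)" if "x \<in> S" for x
    using Suc.prems that assms(1)
    by (auto simp: differentiable_on_eq_differentiable_at frechet_derivative_works)
  \<comment> \<open>The sum rule for derivatives is available at the points of \<open>S\<close>
    only, so it is transported by \<open>Ck_on_cong\<close> and not by rewriting functions.\<close>
  have eq: "frechet_derivative f (at x) v + frechet_derivative g (at x) v =
      frechet_derivative (\<lambda>x. f x + g x) (at x) v" if "x \<in> S" for x v
    using frechet_derivative_at[OF has_derivative_add[OF fd[OF that] gd[OF that]]] by metis
  have "Ck_on k S (\<lambda>x. frechet_derivative (\<lambda>x. f x + g x) (at x) v)" for v
    using Suc by (intro Ck_on_cong[OF assms(1) eq]) auto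
  then show ?case
    using Suc.prems by (auto intro: differentiable_on_add)
qed

lemma Ck_on_mult:
  fixes f g :: "'a::euclidean_space \<Rightarrow> real"
  assumes "open S" "Ck_on k S f" "Ck_on k S g"
  shows "Ck_on k S (\<lambda>x. f x * g x)"
  using assms(2,3)
proof (induction k arbitrary: f g)
  case 0
  then show ?case by (simp add: continuous_on_mult)
next
  case (Suc k)
  have fd: "(f has_derivative frechet_derivative f (at x)) (at x)"
    and gd: "(g has_derivative frechet_derivative g (at x)) (at x)" if "x \<in> S" for x
    using Suc.prems that assms(1)
    by (auto simp: differentiable_on_eq_differentiable_at frechet_derivative_works)
  have eq: "f x * frechet_derivative g (at x) v + frechet_derivative f (at x) v * g x =
      frechet_derivative (\<lambda>x. f x * g x) (at x) v" if "x \<in> S" for x v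
    using frechet_derivative_at[OF has_derivative_mult[OF fd[OF that] gd[OF that]]] by metis
  \<comment> \<open>The product rule keeps one factor undifferentiated, so the induction hypothesis
    at order \<open>k\<close> also needs \<open>f\<close> and \<open>g\<close> themselves at that
    order.\<close>
  have "Ck_on k S f" "Ck_on k S g"
    using Suc.prems by (blast intro: Ck_on_Suc_imp)+
  then have "Ck_on k S (\<lambda>x. frechet_derivative (\<lambda>x. f x * g x) (at x) v)" for v
    using Suc by (intro Ck_on_cong[OF assms(1) eq] Ck_on_add[OF assms(1)]) auto
  then show ?case
    using Suc.prems by (auto intro: differentiable_on_mult)
qed

section \<open>The module of vector fields\<close>

definition scale_field :: "('m \<Rightarrow> real) \<Rightarrow> 'm vector_field \<Rightarrow> 'm vector_field"  (infixr "\<odot>" 75)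
  where "f \<odot> X = (\<lambda>p. f p *\<^sub>R X p)"

lemma scale_field_apply: "(f \<odot> X) p h = f p * X p h"
  by (simp add: scale_field_def scaleR_fun_def)

lemma scaleR_field_apply: "(c *\<^sub>R X) p h = c * (X p h :: real)"
  by (simp add: scaleR_fun_def)

lemma scaleR_eq_scale_field: "c *\<^sub>R X = (\<lambda>_. c) \<odot> X"
  by (simp add: scale_field_def scaleR_fun_def)

locale smooth_atlas =
  fixes A :: "('m::{t2_space, second_countable_topology}, 'e::euclidean_space) atlas"
  assumes manifold: "smooth_manifold A"
begin

abbreviation "SF \<equiv> smooth_functions A"
abbreviation "VF \<equiv> vector_fields A"

lemma open_chart_image: "(U, \<phi>) \<in> A \<Longrightarrow> open (\<phi> ` U)"
  using manifold by (auto simp: smooth_manifold_def)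

lemma SF_const: "(\<lambda>x. c) \<in> SF"
  by (auto simp: smooth_functions_def smooth_on_def comp_def Ck_on_const)

lemma SF_add: "f \<in> SF \<Longrightarrow> h \<in> SF \<Longrightarrow> (\<lambda>x. f x + h x) \<in> SF"
  by (fastforce simp: smooth_functions_def smooth_on_def comp_def
      intro: Ck_on_add[OF open_chart_image])

lemma SF_mult: "f \<in> SF \<Longrightarrow> h \<in> SF \<Longrightarrow> (\<lambda>x. f x * h x) \<in> SF"
  by (fastforce simp: smooth_functions_def smooth_on_def comp_def
      intro: Ck_on_mult[OF open_chart_image])

lemma SF_diff: "f \<in> SF \<Longrightarrow> h \<in> SF \<Longrightarrow> (\<lambda>x. f x - h x) \<in> SF"
  using SF_add[of f "\<lambda>x. - 1 * h x"] SF_mult[OF SF_const, of h "- 1"] by simp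

section \<open>Tangent vectors as derivations\<close>

lemma tangent_add:
  "v \<in> tangent_space A p \<Longrightarrow> f \<in> SF \<Longrightarrow> h \<in> SF \<Longrightarrow> v (\<lambda>x. f x + h x) = v f + v h"
  by (simp add: tangent_space_def)

lemma tangent_cmult: "v \<in> tangent_space A p \<Longrightarrow> f \<in> SF \<Longrightarrow> v (\<lambda>x. c * f x) = c * v f"
  by (simp add: tangent_space_def)

lemma tangent_mult:
  "v \<in> tangent_space A p \<Longrightarrow> f \<in> SF \<Longrightarrow> h \<in> SF \<Longrightarrow> v (\<lambda>x. f x * h x) = f p * v h + h p * v f"
  by (simp add: tangent_space_def)

lemma tangent_nonsmooth: "v \<in> tangent_space A p \<Longrightarrow> f \<notin> SF \<Longrightarrow> v f = 0"
  by (simp add: tangent_space_def)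

lemma tangent_diff:
  assumes "v \<in> tangent_space A p" "f \<in> SF" "h \<in> SF"
  shows "v (\<lambda>x. f x - h x) = v f - v h"
  using tangent_add[OF assms(1,2) SF_mult[OF SF_const assms(3)], of "- 1"]
    tangent_cmult[OF assms(1,3), of "- 1"] by simp

lemma tangent_const:
  assumes "v \<in> tangent_space A p"
  shows "v (\<lambda>x. c) = 0"
proof -
  \<comment> \<open>The Leibniz rule for \<open>1 * 1\<close> gives
    \<open>v 1 = 2 * v 1\<close>.\<close>
  have "v (\<lambda>x. 1) = 0"
    using tangent_mult[OF assms SF_const SF_const, of 1 1] by simp
  then show ?thesis
    using tangent_cmult[OF assms SF_const, of c 1] by simp
qed

lemma subspace_tangent_space: "subspace (tangent_space A p)"
  unfolding subspace_def
  by (auto simp: tangent_space_def scaleR_fun_def algebra_simps)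

lemma VF_tangent: "X \<in> VF \<Longrightarrow> X p \<in> tangent_space A p"
  by (simp add: vector_fields_def)

lemma VF_apply: "X \<in> VF \<Longrightarrow> f \<in> SF \<Longrightarrow> (\<lambda>p. X p f) \<in> SF"
  by (simp add: vector_fields_def)

lemma VF_scale: "f \<in> SF \<Longrightarrow> X \<in> VF \<Longrightarrow> f \<odot> X \<in> VF"
  using subspace_scale[OF subspace_tangent_space]
  by (auto simp: vector_fields_def scale_field_def scaleR_fun_def intro: SF_mult)

lemma VF_add: "X \<in> VF \<Longrightarrow> Y \<in> VF \<Longrightarrow> X + Y \<in> VF"
  using subspace_add[OF subspace_tangent_space]
  by (auto simp: vector_fields_def intro: SF_add)

lemma VF_scaleR: "X \<in> VF \<Longrightarrow> c *\<^sub>R X \<in> VF"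
  by (simp add: scaleR_eq_scale_field VF_scale SF_const)

lemma VF_zero: "0 \<in> VF"
  using subspace_0[OF subspace_tangent_space] SF_const[of 0] by (simp add: vector_fields_def)

lemma subspace_VF: "subspace VF"
  by (simp add: subspace_def VF_add VF_scaleR VF_zero)

lemma VF_diff: "X \<in> VF \<Longrightarrow> Y \<in> VF \<Longrightarrow> X - Y \<in> VF"
  by (rule subspace_diff[OF subspace_VF])

lemma VF_minus: "X \<in> VF \<Longrightarrow> - X \<in> VF"
  by (rule subspace_neg[OF subspace_VF])

lemma VF_sum: "(\<And>i. i \<in> I \<Longrightarrow> F i \<in> VF) \<Longrightarrow> sum F I \<in> VF"
  by (rule subspace_sum[OF subspace_VF])

lemma VF_apply_zero: "X \<in> VF \<Longrightarrow> X p (\<lambda>_. c) = 0"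
  using VF_tangent tangent_const by blast

text \<open>In the Leibniz rule the mixed products of first derivatives cancel. On a nonsmooth
  \<open>f\<close> the inner functions are constantly 0 and vector fields kill constants, so the
  convention on nonsmooth arguments is inherited.\<close>

lemma VF_bracket:
  assumes "X \<in> VF" "Y \<in> VF"
  shows "lie_bracket X Y \<in> VF"
proof -
  note [simp] = VF_tangent VF_apply assms SF_add SF_mult SF_const
  have "lie_bracket X Y p \<in> tangent_space A p" for p
    unfolding tangent_space_def
    by (auto simp: lie_bracket_def assms[THEN VF_tangent, THEN tangent_add]
        assms[THEN VF_tangent, THEN tangent_cmult] assms[THEN VF_tangent, THEN tangent_mult]
        assms[THEN VF_tangent, THEN tangent_nonsmooth] assms[THEN VF_apply_zero] algebra_simps)
  moreover have "(\<lambda>p. lie_bracket X Y p f) \<in> SF" if "f \<in> SF" for f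
    using that by (simp add: lie_bracket_def SF_diff)
  ultimately show ?thesis
    unfolding vector_fields_def by blast
qed

lemma VF_eqI:
  assumes "X \<in> VF" "Y \<in> VF" "\<And>p h. h \<in> SF \<Longrightarrow> X p h = Y p h"
  shows "X = Y"
proof (intro ext)
  fix p h
  show "X p h = Y p h"
    using assms(3) assms(1,2)[THEN VF_tangent, THEN tangent_nonsmooth] by (cases "h \<in> SF") auto
qed

lemma bracket_swap: "lie_bracket X Y = - lie_bracket Y X"
  by (simp add: lie_bracket_def fun_eq_iff)

lemmas VF_rules = VF_add VF_diff VF_minus VF_zero VF_scale VF_scaleR VF_bracket SF_const VF_apply

lemma bracket_add_left:
  assumes "X \<in> VF" "Y \<in> VF" "Z \<in> VF"
  shows "lie_bracket (X + Y) Z = lie_bracket X Z + lie_bracket Y Z"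
proof (rule VF_eqI)
  show "lie_bracket (X + Y) Z p h = (lie_bracket X Z + lie_bracket Y Z) p h" if "h \<in> SF" for p h
    using that by (simp add: lie_bracket_def assms VF_apply assms(3)[THEN VF_tangent, THEN tangent_add])
qed (simp_all add: assms VF_rules)

lemma bracket_scale_left:
  assumes "f \<in> SF" "X \<in> VF" "Y \<in> VF"
  shows "lie_bracket (f \<odot> X) Y = f \<odot> lie_bracket X Y - (\<lambda>p. Y p f) \<odot> X"
proof (rule VF_eqI)
  show "lie_bracket (f \<odot> X) Y p h = (f \<odot> lie_bracket X Y - (\<lambda>p. Y p f) \<odot> X) p h"
    if "h \<in> SF" for p h
    using that by (simp add: lie_bracket_def assms VF_apply scale_field_apply
        assms(3)[THEN VF_tangent, THEN tangent_mult] algebra_simps)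
qed (simp_all add: assms VF_rules)

lemma bracket_scaleR_left:
  assumes "X \<in> VF" "Y \<in> VF"
  shows "lie_bracket (c *\<^sub>R X) Y = c *\<^sub>R lie_bracket X Y"
  using bracket_scale_left[OF SF_const assms, of c]
  by (simp add: scaleR_eq_scale_field VF_apply_zero assms fun_eq_iff scale_field_apply)

lemma bracket_add_right:
  assumes "X \<in> VF" "Y \<in> VF" "Z \<in> VF"
  shows "lie_bracket Z (X + Y) = lie_bracket Z X + lie_bracket Z Y"
  using bracket_add_left[OF assms] bracket_swap[of Z] by simp

lemma bracket_scaleR_right:
  assumes "X \<in> VF" "Y \<in> VF"
  shows "lie_bracket Y (c *\<^sub>R X) = c *\<^sub>R lie_bracket Y X"
  using bracket_scaleR_left[OF assms] bracket_swap[of Y] by simp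

text \<open>The derivation form of the identity: it lets a field be moved into nested brackets,
  which is how curvature and its derivative are simplified below.\<close>

lemma jacobi:
  assumes "X \<in> VF" "Y \<in> VF" "Z \<in> VF"
  shows "lie_bracket X (lie_bracket Y Z) = lie_bracket (lie_bracket X Y) Z + lie_bracket Y (lie_bracket X Z)"
proof (rule VF_eqI)
  show "lie_bracket X (lie_bracket Y Z) p h =
      (lie_bracket (lie_bracket X Y) Z + lie_bracket Y (lie_bracket X Z)) p h" if "h \<in> SF" for p h
    using that
    by (simp add: lie_bracket_def assms VF_apply assms[THEN VF_tangent, THEN tangent_diff])
qed (simp_all add: assms VF_rules)

end

section \<open>Tensoriality\<close>

text \<open>Only one argument is free: tensors of several arguments are treated slot by slot with
  the others fixed.\<close>

definition tensorial ::
  "('m, 'e::euclidean_space) atlas \<Rightarrow> ('m vector_field \<Rightarrow> 'm vector_field) \<Rightarrow> bool" where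
  "tensorial A T \<longleftrightarrow>
     (\<forall>X\<in>vector_fields A. \<forall>Y\<in>vector_fields A. T (X + Y) = T X + T Y) \<and>
     (\<forall>f\<in>smooth_functions A. \<forall>X\<in>vector_fields A. T (f \<odot> X) = f \<odot> T X)"

lemma tensorial_add:
  "tensorial A T \<Longrightarrow> X \<in> vector_fields A \<Longrightarrow> Y \<in> vector_fields A \<Longrightarrow> T (X + Y) = T X + T Y"
  by (simp add: tensorial_def)

lemma tensorial_scale:
  "tensorial A T \<Longrightarrow> f \<in> smooth_functions A \<Longrightarrow> X \<in> vector_fields A \<Longrightarrow> T (f \<odot> X) = f \<odot> T X"
  by (simp add: tensorial_def)

lemma tensorial_minus: "tensorial A T \<Longrightarrow> tensorial A (\<lambda>X. - T X)"
  by (simp add: tensorial_def fun_eq_iff scale_field_apply)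

lemma scale_field_distrib:
  "f \<odot> (X + Y) = f \<odot> X + f \<odot> Y" "f \<odot> (X - Y) = f \<odot> X - f \<odot> Y" "f \<odot> (- X) = - (f \<odot> X)"
  by (simp_all add: fun_eq_iff scale_field_apply algebra_simps)

section \<open>The Nijenhuis tensor\<close>

locale almost_complex_atlas = smooth_atlas A
  for A :: "('m::{t2_space, second_countable_topology}, 'e::euclidean_space) atlas" +
  fixes J :: "'m endomorphism_field"
  assumes acs: "almost_complex_structure A J"
begin

abbreviation "JF \<equiv> apply_field J"

lemma VF_J: "X \<in> VF \<Longrightarrow> JF X \<in> VF"
  using acs by (simp add: almost_complex_structure_def)

lemma J_add: "X \<in> VF \<Longrightarrow> Y \<in> VF \<Longrightarrow> JF (X + Y) = JF X + JF Y"
  using acs by (simp add: almost_complex_structure_def apply_field_def fun_eq_iff VF_tangent)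

lemma J_scale: "X \<in> VF \<Longrightarrow> JF (f \<odot> X) = f \<odot> JF X"
  using acs
  by (simp add: almost_complex_structure_def apply_field_def fun_eq_iff VF_tangent scale_field_def)

lemma J_scaleR: "X \<in> VF \<Longrightarrow> JF (c *\<^sub>R X) = c *\<^sub>R JF X"
  by (simp add: scaleR_eq_scale_field J_scale)

lemma J_minus: "X \<in> VF \<Longrightarrow> JF (- X) = - JF X"
  using J_scaleR[of X "- 1"] by simp

lemma J_diff: "X \<in> VF \<Longrightarrow> Y \<in> VF \<Longrightarrow> JF (X - Y) = JF X - JF Y"
  using J_add[of X "- Y"] by (simp add: J_minus VF_minus)

lemma J_J: "X \<in> VF \<Longrightarrow> JF (JF X) = - X"
  using acs by (simp add: almost_complex_structure_def apply_field_def fun_eq_iff VF_tangent)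

lemma VF_nijenhuis: "X \<in> VF \<Longrightarrow> Y \<in> VF \<Longrightarrow> nijenhuis J X Y \<in> VF"
  by (simp add: nijenhuis_def VF_rules VF_J)

lemma nijenhuis_swap:
  assumes "X \<in> VF" "Y \<in> VF"
  shows "nijenhuis J X Y = - nijenhuis J Y X"
  using assms J_minus[OF VF_bracket]
  unfolding nijenhuis_def bracket_swap[of X] bracket_swap[of "JF X"]
  by (simp add: VF_J)

text \<open>The derivatives of \<open>f\<close> cancel in pairs: the terms in \<open>Y f\<close>
  from the first two brackets by \<open>J\<^sup>2 = - 1\<close>, those in \<open>(J Y) f\<close>
  from the last two directly.\<close>

lemma nijenhuis_tensorial1:
  assumes "Y \<in> VF"
  shows "tensorial A (\<lambda>X. nijenhuis J X Y)"
  unfolding tensorial_def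
proof safe
  fix X Z assume "X \<in> VF" "Z \<in> VF"
  then show "nijenhuis J (X + Z) Y = nijenhuis J X Y + nijenhuis J Z Y"
    using assms by (simp add: nijenhuis_def VF_rules VF_J J_add bracket_add_left)
next
  fix f X assume "f \<in> SF" "X \<in> VF"
  then show "nijenhuis J (f \<odot> X) Y = f \<odot> nijenhuis J X Y"
    using assms
    by (simp add: nijenhuis_def VF_rules VF_J J_diff J_scale J_J bracket_scale_left
        scale_field_distrib)
qed

lemma nijenhuis_tensorial2:
  assumes "X \<in> VF"
  shows "tensorial A (\<lambda>Y. nijenhuis J X Y)"
  using tensorial_minus[OF nijenhuis_tensorial1[OF assms]] nijenhuis_swap[OF assms]
  by (simp add: tensorial_def VF_rules)

end

section \<open>Affine connections and their curvature\<close>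

locale affine_atlas = smooth_atlas A
  for A :: "('m::{t2_space, second_countable_topology}, 'e::euclidean_space) atlas" +
  fixes D :: "'m connection"
  assumes affine: "affine_connection A D"
begin

lemma VF_D: "X \<in> VF \<Longrightarrow> Y \<in> VF \<Longrightarrow> D X Y \<in> VF"
  using affine by (simp add: affine_connection_def)

lemma D_add_left: "X \<in> VF \<Longrightarrow> Y \<in> VF \<Longrightarrow> Z \<in> VF \<Longrightarrow> D (X + Y) Z = D X Z + D Y Z"
  using affine by (simp add: affine_connection_def)

lemma D_add_right: "X \<in> VF \<Longrightarrow> Y \<in> VF \<Longrightarrow> Z \<in> VF \<Longrightarrow> D X (Y + Z) = D X Y + D X Z"
  using affine by (simp add: affine_connection_def)

lemma D_scale_left: "f \<in> SF \<Longrightarrow> X \<in> VF \<Longrightarrow> Y \<in> VF \<Longrightarrow> D (f \<odot> X) Y = f \<odot> D X Y"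
  using affine by (simp add: affine_connection_def scale_field_def)

lemma D_scale_right:
  "f \<in> SF \<Longrightarrow> X \<in> VF \<Longrightarrow> Y \<in> VF \<Longrightarrow> D X (f \<odot> Y) = (\<lambda>p. X p f) \<odot> Y + f \<odot> D X Y"
  using affine by (simp add: affine_connection_def scale_field_def plus_fun_def)

lemma D_scaleR_left: "X \<in> VF \<Longrightarrow> Y \<in> VF \<Longrightarrow> D (c *\<^sub>R X) Y = c *\<^sub>R D X Y"
  by (simp add: scaleR_eq_scale_field D_scale_left SF_const)

lemma D_scaleR_right: "X \<in> VF \<Longrightarrow> Y \<in> VF \<Longrightarrow> D X (c *\<^sub>R Y) = c *\<^sub>R D X Y"
  by (simp add: scaleR_eq_scale_field D_scale_right SF_const VF_apply_zero)
    (simp add: fun_eq_iff scale_field_apply)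

lemma D_minus_left: "X \<in> VF \<Longrightarrow> Y \<in> VF \<Longrightarrow> D (- X) Y = - D X Y"
  using D_scaleR_left[of X Y "- 1"] by simp

lemma D_minus_right: "X \<in> VF \<Longrightarrow> Y \<in> VF \<Longrightarrow> D X (- Y) = - D X Y"
  using D_scaleR_right[of X Y "- 1"] by simp

lemma D_diff_left: "X \<in> VF \<Longrightarrow> Y \<in> VF \<Longrightarrow> Z \<in> VF \<Longrightarrow> D (X - Y) Z = D X Z - D Y Z"
  using D_add_left[of X "- Y"] by (simp add: D_minus_left VF_minus)

lemma D_diff_right: "X \<in> VF \<Longrightarrow> Y \<in> VF \<Longrightarrow> Z \<in> VF \<Longrightarrow> D X (Y - Z) = D X Y - D X Z"
  using D_add_right[of X Y "- Z"] by (simp add: D_minus_right VF_minus)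

lemmas D_linear = D_add_left D_add_right D_diff_left D_diff_right D_minus_left D_minus_right

lemma VF_curvature: "X \<in> VF \<Longrightarrow> Y \<in> VF \<Longrightarrow> Z \<in> VF \<Longrightarrow> curvature D X Y Z \<in> VF"
  by (simp add: curvature_def VF_rules VF_D)

lemma curvature_swap:
  assumes "X \<in> VF" "Y \<in> VF" "Z \<in> VF"
  shows "curvature D X Y Z = - curvature D Y X Z"
  using assms unfolding curvature_def bracket_swap[of X]
  by (simp add: D_minus_left VF_rules)

text \<open>The term \<open>- (Y f) D X Z\<close> from the second summand is cancelled by the
  derivative part of \<open>lie_bracket (f \<odot> X) Y\<close>.\<close>

lemma curvature_tensorial1:
  assumes "Y \<in> VF" "Z \<in> VF"
  shows "tensorial A (\<lambda>X. curvature D X Y Z)"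
  unfolding tensorial_def
proof safe
  fix X W assume "X \<in> VF" "W \<in> VF"
  then show "curvature D (X + W) Y Z = curvature D X Y Z + curvature D W Y Z"
    using assms by (simp add: curvature_def VF_rules VF_D D_linear bracket_add_left)
next
  fix f X assume "f \<in> SF" "X \<in> VF"
  then show "curvature D (f \<odot> X) Y Z = f \<odot> curvature D X Y Z"
    using assms
    by (simp add: curvature_def VF_rules VF_D D_linear D_scale_left D_scale_right
        bracket_scale_left scale_field_distrib)
qed

lemma curvature_tensorial2:
  assumes "X \<in> VF" "Z \<in> VF"
  shows "tensorial A (\<lambda>Y. curvature D X Y Z)"
  using tensorial_minus[OF curvature_tensorial1[OF assms]] curvature_swap[OF assms(1) _ assms(2)]
  by (simp add: tensorial_def VF_rules)

text \<open>The mixed first-order terms cancel, and the coefficient of \<open>Z\<close> is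
  \<open>X (Y f) - Y (X f) - [X, Y] f = 0\<close>.\<close>

lemma curvature_tensorial3:
  assumes "X \<in> VF" "Y \<in> VF"
  shows "tensorial A (\<lambda>Z. curvature D X Y Z)"
  unfolding tensorial_def
proof safe
  fix Z W assume "Z \<in> VF" "W \<in> VF"
  then show "curvature D X Y (Z + W) = curvature D X Y Z + curvature D X Y W"
    using assms by (simp add: curvature_def VF_rules VF_D D_linear)
next
  fix f Z assume "f \<in> SF" "Z \<in> VF"
  then show "curvature D X Y (f \<odot> Z) = f \<odot> curvature D X Y Z"
    using assms
    by (simp add: curvature_def VF_rules VF_D D_linear D_scale_left D_scale_right scale_field_distrib)
      (simp add: fun_eq_iff scale_field_apply lie_bracket_def algebra_simps)
qed

lemmas curvature_add = curvature_tensorial1[THEN tensorial_add] curvature_tensorial2[THEN tensorial_add]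
  curvature_tensorial3[THEN tensorial_add]

lemmas curvature_scale = curvature_tensorial1[THEN tensorial_scale]
  curvature_tensorial2[THEN tensorial_scale] curvature_tensorial3[THEN tensorial_scale]

text \<open>In each of the last three slots the leading summand produces \<open>W f\<close> times
  the curvature, and the correction for that slot removes exactly this term.\<close>

lemma deriv_curvature_tensorial:
  assumes "W \<in> VF" "X \<in> VF" "Y \<in> VF" "Z \<in> VF"
  shows "tensorial A (\<lambda>W. deriv_curvature D W X Y Z)" "tensorial A (\<lambda>X. deriv_curvature D W X Y Z)"
    "tensorial A (\<lambda>Y. deriv_curvature D W X Y Z)" "tensorial A (\<lambda>Z. deriv_curvature D W X Y Z)"
  using assms
  by (simp_all add: tensorial_def deriv_curvature_def VF_rules VF_D VF_curvature D_linear
      D_scale_left D_scale_right curvature_add curvature_scale scale_field_distrib)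

end

section \<open>The covariant derivative of the almost complex structure\<close>

locale affine_almost_complex_atlas = almost_complex_atlas A J + affine_atlas A D
  for A :: "('m::{t2_space, second_countable_topology}, 'e::euclidean_space) atlas" and J D
begin

lemma VF_deriv_endomorphism: "X \<in> VF \<Longrightarrow> Y \<in> VF \<Longrightarrow> deriv_endomorphism D J X Y \<in> VF"
  by (simp add: deriv_endomorphism_def VF_rules VF_J VF_D)

lemma deriv_endomorphism_tensorial1:
  "Y \<in> VF \<Longrightarrow> tensorial A (\<lambda>X. deriv_endomorphism D J X Y)"
  by (simp add: tensorial_def deriv_endomorphism_def VF_rules VF_J VF_D D_linear J_add
      D_scale_left J_scale scale_field_distrib)

lemma deriv_endomorphism_tensorial2:
  "X \<in> VF \<Longrightarrow> tensorial A (\<lambda>Y. deriv_endomorphism D J X Y)"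
  by (simp add: tensorial_def deriv_endomorphism_def VF_rules VF_J VF_D D_linear J_add
      D_scale_right J_scale scale_field_distrib)

end

section \<open>Orthonormal frames and metric contractions\<close>

lemma sum_field_apply: "sum F I p = (\<Sum>i\<in>I. F i p)"
  for F :: "'i \<Rightarrow> 'a \<Rightarrow> 'b::comm_monoid_add"
  by (induction I rule: infinite_finite_induct) auto

lemma sum_mult_delta:
  fixes f :: "'n::finite \<Rightarrow> real"
  shows "(\<Sum>k\<in>UNIV. (if a = k then d else 0) * f k) = d * f a"
    and "(\<Sum>k\<in>UNIV. f k * (if k = a then c k else 0)) = f a * c a"
proof -
  have "(\<Sum>k\<in>UNIV. (if a = k then d else 0) * f k) = (\<Sum>k\<in>UNIV. if a = k then d * f k else 0)"
    by (rule sum.cong) auto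
  then show "(\<Sum>k\<in>UNIV. (if a = k then d else 0) * f k) = d * f a"
    by simp
  have "(\<Sum>k\<in>UNIV. f k * (if k = a then c k else 0)) = (\<Sum>k\<in>UNIV. if k = a then f k * c k else 0)"
    by (rule sum.cong) auto
  then show "(\<Sum>k\<in>UNIV. f k * (if k = a then c k else 0)) = f a * c a"
    by simp
qed

lemma sum_swap_pairs:
  "(\<Sum>i\<in>I. \<Sum>j\<in>J. \<Sum>a\<in>K. \<Sum>b\<in>L. F i j a b) = (\<Sum>a\<in>K. \<Sum>b\<in>L. \<Sum>i\<in>I. \<Sum>j\<in>J. F i j a b)"
proof -
  have "(\<Sum>j\<in>J. \<Sum>a\<in>K. \<Sum>b\<in>L. F i j a b) = (\<Sum>a\<in>K. \<Sum>b\<in>L. \<Sum>j\<in>J. F i j a b)" for i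
    by (subst sum.swap) (intro sum.cong refl sum.swap)
  then have "(\<Sum>i\<in>I. \<Sum>j\<in>J. \<Sum>a\<in>K. \<Sum>b\<in>L. F i j a b) =
      (\<Sum>i\<in>I. \<Sum>a\<in>K. \<Sum>b\<in>L. \<Sum>j\<in>J. F i j a b)"
    by simp
  also have "\<dots> = (\<Sum>a\<in>K. \<Sum>b\<in>L. \<Sum>i\<in>I. \<Sum>j\<in>J. F i j a b)"
    by (subst sum.swap) (intro sum.cong refl sum.swap)
  finally show ?thesis .
qed

lemma matrix_inv_eqI:
  fixes M :: "real^'n^'n"
  assumes "N ** M = mat 1"
  shows "matrix_inv M = N"
proof -
  have "M ** N = mat 1"
    using assms matrix_left_right_inverse by blast
  then have "M ** matrix_inv M = mat 1 \<and> matrix_inv M ** M = mat 1"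
    unfolding matrix_inv_def
    by (intro someI[of "\<lambda>N. M ** N = mat 1 \<and> N ** M = mat 1" N]) (simp add: assms)
  then show ?thesis
    using assms by (metis matrix_mul_assoc matrix_mul_lid matrix_mul_rid)
qed

section \<open>Pseudo-Riemannian metrics\<close>

locale metric_atlas = smooth_atlas A
  for A :: "('m::{t2_space, second_countable_topology}, 'e::euclidean_space) atlas" +
  fixes g :: "'m metric"
  assumes metric: "pseudo_riemannian_metric A g"
begin

lemma SF_metric: "X \<in> VF \<Longrightarrow> Y \<in> VF \<Longrightarrow> (\<lambda>p. g p (X p) (Y p)) \<in> SF"
  using metric by (simp add: pseudo_riemannian_metric_def)

lemma metric_sym: "u \<in> tangent_space A p \<Longrightarrow> v \<in> tangent_space A p \<Longrightarrow> g p u v = g p v u"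
  using metric by (simp add: pseudo_riemannian_metric_def)

lemma metric_add_left:
  "u \<in> tangent_space A p \<Longrightarrow> v \<in> tangent_space A p \<Longrightarrow> w \<in> tangent_space A p \<Longrightarrow>
    g p (u + v) w = g p u w + g p v w"
  using metric by (simp add: pseudo_riemannian_metric_def)

lemma metric_scale_left:
  "v \<in> tangent_space A p \<Longrightarrow> w \<in> tangent_space A p \<Longrightarrow> g p (c *\<^sub>R v) w = c * g p v w"
  using metric by (simp add: pseudo_riemannian_metric_def)

lemma metric_sum_left:
  assumes "\<And>i. i \<in> I \<Longrightarrow> F i \<in> tangent_space A p" "w \<in> tangent_space A p"
  shows "g p (\<Sum>i\<in>I. c i *\<^sub>R F i) w = (\<Sum>i\<in>I. c i * g p (F i) w)"
  using assms(1)
proof (induction I rule: infinite_finite_induct)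
  case (insert i I)
  moreover have "(\<Sum>i\<in>I. c i *\<^sub>R F i) \<in> tangent_space A p"
    by (intro subspace_sum[OF subspace_tangent_space] subspace_scale[OF subspace_tangent_space])
      (use insert.prems in auto)
  ultimately show ?case
    unfolding sum.insert[OF insert.hyps]
    using assms(2)
    by (simp only: metric_add_left metric_scale_left subspace_scale[OF subspace_tangent_space]
        insertI1 insertI2)
qed (use metric_scale_left[OF assms(2,2), of 0] in simp_all)

lemma metric_sum_right:
  assumes "\<And>i. i \<in> I \<Longrightarrow> F i \<in> tangent_space A p" "w \<in> tangent_space A p"
  shows "g p w (\<Sum>i\<in>I. c i *\<^sub>R F i) = (\<Sum>i\<in>I. c i * g p w (F i))"
proof -
  have "(\<Sum>i\<in>I. c i *\<^sub>R F i) \<in> tangent_space A p"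
    by (intro subspace_sum[OF subspace_tangent_space] subspace_scale[OF subspace_tangent_space])
      (use assms in auto)
  then show ?thesis
    using assms by (simp add: metric_sum_left metric_sym[of w])
qed

end

text \<open>The signature is left open. Each \<open>\<eta> i\<close> is 1 or -1, hence its own
  inverse, so the same numbers serve as entries of the Gram matrix and of its inverse.\<close>

locale orthonormal_frame = metric_atlas A g
  for A :: "('m::{t2_space, second_countable_topology}, 'e::euclidean_space) atlas" and g +
  fixes X :: "'n::finite \<Rightarrow> 'm vector_field" and \<eta> :: "'n \<Rightarrow> real"
  assumes frame: "global_frame A X"
    and gram: "g p (X i p) (X j p) = (if i = j then \<eta> i else 0)"
    and sign: "\<eta> i * \<eta> i = 1"
begin

lemma VF_X: "X i \<in> VF"
  using frame by (simp add: global_frame_def)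

lemma tangent_X: "X i p \<in> tangent_space A p"
  by (simp add: VF_X VF_tangent)

lemma tangent_expansion:
  assumes "v \<in> tangent_space A p"
  shows "v = (\<Sum>i\<in>UNIV. (\<eta> i * g p v (X i p)) *\<^sub>R X i p)"
proof -
  \<comment> \<open>The vectors that satisfy the expansion form a subspace containing the frame at
    \<open>p\<close>, and the frame spans.\<close>
  let ?V = "{v \<in> tangent_space A p. v = (\<Sum>i\<in>UNIV. (\<eta> i * g p v (X i p)) *\<^sub>R X i p)}"
  have "v \<in> span (range (\<lambda>i. X i p))"
    using frame assms by (simp add: global_frame_def tangent_basis_def)
  also have "\<dots> \<subseteq> ?V"
  proof (rule span_minimal)
    have "X j p = (\<Sum>i\<in>UNIV. (\<eta> i * g p (X j p) (X i p)) *\<^sub>R X i p)" for j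
    proof -
      have "(\<Sum>i\<in>UNIV. (\<eta> i * g p (X j p) (X i p)) *\<^sub>R X i p) =
          (\<Sum>i\<in>UNIV. if j = i then X i p else 0)"
        by (rule sum.cong) (auto simp: gram sign)
      then show ?thesis by simp
    qed
    then show "range (\<lambda>i. X i p) \<subseteq> ?V"
      using tangent_X by auto
    have "(\<Sum>i\<in>UNIV. (\<eta> i * g p (u + v) (X i p)) *\<^sub>R X i p) = u + v"
      if "u \<in> ?V" "v \<in> ?V" for u v
    proof -
      have "(\<Sum>i\<in>UNIV. (\<eta> i * g p (u + v) (X i p)) *\<^sub>R X i p) =
          (\<Sum>i\<in>UNIV. (\<eta> i * g p u (X i p)) *\<^sub>R X i p) + (\<Sum>i\<in>UNIV. (\<eta> i * g p v (X i p)) *\<^sub>R X i p)"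
      proof -
        have "u \<in> tangent_space A p" "v \<in> tangent_space A p"
          using that by auto
        then show ?thesis
          by (simp only: metric_add_left tangent_X scaleR_add_left distrib_left sum.distrib)
      qed
      also have "\<dots> = u + v"
        using that by simp
      finally show ?thesis .
    qed
    moreover have "(\<Sum>i\<in>UNIV. (\<eta> i * g p (c *\<^sub>R v) (X i p)) *\<^sub>R X i p) = c *\<^sub>R v" if "v \<in> ?V" for c v
    proof -
      have "(\<Sum>i\<in>UNIV. (\<eta> i * g p (c *\<^sub>R v) (X i p)) *\<^sub>R X i p) =
          c *\<^sub>R (\<Sum>i\<in>UNIV. (\<eta> i * g p v (X i p)) *\<^sub>R X i p)"
      proof -
        have "v \<in> tangent_space A p"
          using that by auto
        then show ?thesis
          by (simp only: metric_scale_left tangent_X scaleR_sum_right mult.left_commute scaleR_scaleR)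
      qed
      also have "\<dots> = c *\<^sub>R v"
        using that by simp
      finally show ?thesis .
    qed
    moreover have "g p 0 (X i p) = 0" for i
      using metric_scale_left[OF tangent_X tangent_X, where c = 0] by simp
    ultimately show "subspace ?V"
      using subspace_tangent_space[of p] unfolding subspace_def by auto
  qed
  finally show ?thesis by blast
qed

definition coord :: "'m vector_field \<Rightarrow> 'n \<Rightarrow> 'm \<Rightarrow> real" where
  "coord Y i = (\<lambda>p. \<eta> i * g p (Y p) (X i p))"

lemma SF_coord: "Y \<in> VF \<Longrightarrow> coord Y i \<in> SF"
  unfolding coord_def by (intro SF_mult SF_const SF_metric VF_X)

lemma frame_expansion:
  assumes "Y \<in> VF"
  shows "Y = (\<Sum>i\<in>UNIV. coord Y i \<odot> X i)"
proof
  show "Y p = (\<Sum>i\<in>UNIV. coord Y i \<odot> X i) p" for p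
    using tangent_expansion[OF VF_tangent[OF assms], of p]
    by (simp add: sum_field_apply scale_field_def coord_def)
qed

lemma metric_eqI:
  assumes "u \<in> tangent_space A p" "v \<in> tangent_space A p" "\<And>i. g p u (X i p) = g p v (X i p)"
  shows "u = v"
  using tangent_expansion[OF assms(1)] tangent_expansion[OF assms(2)] assms(3) by simp

lemma tensorial_expansion:
  assumes T: "tensorial A T" and Y: "Y \<in> VF"
  shows "T Y = (\<Sum>i\<in>UNIV. coord Y i \<odot> T (X i))"
proof -
  have "T 0 = 0"
    using tensorial_scale[OF T SF_const VF_zero, of 0] by (simp add: scale_field_def zero_fun_def)
  then have "T (\<Sum>i\<in>I. coord Y i \<odot> X i) = (\<Sum>i\<in>I. coord Y i \<odot> T (X i))" for I :: "'n set"
  proof (induction I rule: infinite_finite_induct)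
    case (insert i I)
    then show ?case
      unfolding sum.insert[OF insert.hyps]
      by (simp only: tensorial_add[OF T VF_scale[OF SF_coord[OF Y] VF_X]
            VF_sum[OF VF_scale[OF SF_coord[OF Y] VF_X]]] tensorial_scale[OF T SF_coord[OF Y] VF_X])
  qed auto
  from this[of UNIV] frame_expansion[OF Y] show ?thesis by simp
qed

lemma tensorial_eq_0:
  assumes "tensorial A T" "\<And>i. T (X i) = 0" "Y \<in> VF"
  shows "T Y = 0"
  using tensorial_expansion[OF assms(1,3)] assms(2)
  by (simp add: fun_eq_iff sum_field_apply scale_field_apply)

text \<open>
  If \<open>P\<close> is the matrix expressing \<open>E\<close> in the frame and \<open>H\<close> is the Gram matrix of the frame, the
  Gram matrix of \<open>E\<close> is \<open>P H P\<^sup>T\<close>, so the contraction with its inverse does not depend on \<open>E\<close>.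
\<close>

lemma inverse_gram_contraction:
  fixes E :: "'n \<Rightarrow> 'm vector_field"
  assumes "\<And>i. E i \<in> VF" "tangent_basis A p (\<lambda>i. E i p)"
  shows "(\<Sum>i\<in>UNIV. \<Sum>j\<in>UNIV. inverse_gram g E p $ i $ j * (coord (E i) a p * coord (E j) b p)) =
    (if a = b then \<eta> a else 0)"
proof -
  define P :: "real^'n^'n" where "P = (\<chi> i a. coord (E i) a p)"
  define H :: "real^'n^'n" where "H = (\<chi> a b. if a = b then \<eta> a else 0)"
  define G :: "real^'n^'n" where "G = (\<chi> i j. g p (E i p) (E j p))"
  note [simp] = assms(1) VF_tangent tangent_X
  have "\<exists>c. v = (\<Sum>i\<in>UNIV. c i *\<^sub>R E i p)" if "v \<in> tangent_space A p" for v
  proof -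
    have "v \<in> span (range (\<lambda>i. E i p))" "inj (\<lambda>i. E i p)"
      using assms(2) that by (simp_all add: tangent_basis_def)
    then show ?thesis
      by (auto simp: span_finite sum.reindex)
  qed
  then have "\<forall>a. \<exists>c. X a p = (\<Sum>i\<in>UNIV. c i *\<^sub>R E i p)"
    using tangent_X by blast
  from choice[OF this] obtain q where q: "\<And>a. X a p = (\<Sum>i\<in>UNIV. q a i *\<^sub>R E i p)"
    by blast
  \<comment> \<open>The reverse change of basis, read off from the fact that \<open>E\<close> spans
    at \<open>p\<close>. It makes the inverse Gram matrix explicit as \<open>Q\<^sup>T H Q\<close>,
    because \<open>H\<close> is its own inverse.\<close>
  define Q :: "real^'n^'n" where "Q = (\<chi> a i. q a i)"
  have "Q ** P = mat 1"
  proof -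
    have "(\<Sum>i\<in>UNIV. q a i * (\<eta> b * g p (E i p) (X b p))) = (if a = b then 1 else 0)" for a b
    proof -
      have "(\<Sum>i\<in>UNIV. q a i * (\<eta> b * g p (E i p) (X b p))) = \<eta> b * g p (X a p) (X b p)"
        by (simp add: q[of a] metric_sum_left sum_distrib_left mult.left_commute)
      then show ?thesis
        by (simp add: gram sign)
    qed
    then show ?thesis
      by (simp add: vec_eq_iff matrix_matrix_mult_def mat_def P_def Q_def coord_def)
  qed
  then have PQ: "P ** Q = mat 1"
    using matrix_left_right_inverse by blast
  have HH: "H ** H = mat 1"
    by (simp add: vec_eq_iff matrix_matrix_mult_def mat_def H_def sum_mult_delta sign)
  have "G $ i $ j = (P ** H ** transpose P) $ i $ j" for i j
  proof -
    have "G $ i $ j = g p (\<Sum>a\<in>UNIV. coord (E i) a p *\<^sub>R X a p) (E j p)"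
      using tangent_expansion[OF VF_tangent[OF assms(1)[of i]], of p]
      by (simp add: G_def coord_def)
    also have "\<dots> = (\<Sum>a\<in>UNIV. coord (E i) a p * (\<eta> a * coord (E j) a p))"
      by (simp add: metric_sum_left coord_def metric_sym[of "X _ p"] sign flip: mult.assoc[of "\<eta> _" "\<eta> _"])
    also have "\<dots> = (P ** H ** transpose P) $ i $ j"
      by (simp add: matrix_matrix_mult_def P_def H_def transpose_def sum_mult_delta mult.assoc)
    finally show ?thesis .
  qed
  then have G: "G = P ** H ** transpose P"
    by (simp add: vec_eq_iff)
  have "(transpose Q ** H ** Q) ** G = transpose Q ** (H ** ((Q ** P) ** H)) ** transpose P"
    unfolding G by (simp add: matrix_mul_assoc)
  also have "\<dots> = transpose (P ** Q)"
    by (simp add: \<open>Q ** P = mat 1\<close> HH matrix_transpose_mul)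
  finally have "(transpose Q ** H ** Q) ** G = mat 1"
    by (simp add: PQ transpose_mat)
  then have inv: "inverse_gram g E p = transpose Q ** H ** Q"
    unfolding inverse_gram_def G_def by (rule matrix_inv_eqI)
  have "(\<Sum>i\<in>UNIV. \<Sum>j\<in>UNIV. inverse_gram g E p $ i $ j * (coord (E i) a p * coord (E j) b p)) =
      (transpose P ** (inverse_gram g E p ** P)) $ a $ b"
    by (simp add: matrix_matrix_mult_def transpose_def P_def sum_distrib_left mult_ac)
  also have "transpose P ** (inverse_gram g E p ** P) = transpose (Q ** P) ** H ** (Q ** P)"
    by (simp add: inv matrix_transpose_mul matrix_mul_assoc)
  also have "\<dots> = H"
    by (simp add: \<open>Q ** P = mat 1\<close> transpose_mat)
  finally show ?thesis
    by (simp add: H_def)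
qed

text \<open>A covector at \<open>p\<close> in the guise of a functional on fields. Real values at a
  fixed point suffice for contractions, and sums of such functionals, such as partial traces, stay
  in the class.\<close>

definition tensor_form :: "'m \<Rightarrow> ('m vector_field \<Rightarrow> real) \<Rightarrow> bool" where
  "tensor_form p \<phi> \<longleftrightarrow> (\<forall>Y\<in>VF. \<phi> Y = (\<Sum>i\<in>UNIV. coord Y i p * \<phi> (X i)))"

lemma tensor_form_metric:
  assumes "tensorial A T" "\<And>Y. Y \<in> VF \<Longrightarrow> T Y \<in> VF" "v \<in> tangent_space A p"
  shows "tensor_form p (\<lambda>Y. g p (T Y p) v)" "tensor_form p (\<lambda>Y. g p v (T Y p))"
proof -
  have expansion: "T Y p = (\<Sum>i\<in>UNIV. coord Y i p *\<^sub>R T (X i) p)" if "Y \<in> VF" for Y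
    using tensorial_expansion[OF assms(1) that] by (simp add: sum_field_apply scale_field_def)
  have "g p (T Y p) v = (\<Sum>i\<in>UNIV. coord Y i p * g p (T (X i) p) v)"
      "g p v (T Y p) = (\<Sum>i\<in>UNIV. coord Y i p * g p v (T (X i) p))" if "Y \<in> VF" for Y
    by (simp_all only: expansion[OF that] metric_sum_left metric_sum_right assms(2,3) VF_tangent VF_X)
  then show "tensor_form p (\<lambda>Y. g p (T Y p) v)" "tensor_form p (\<lambda>Y. g p v (T Y p))"
    by (simp_all add: tensor_form_def)
qed

lemma tensor_form_sum:
  assumes "\<And>i. i \<in> I \<Longrightarrow> tensor_form p (\<phi> i)"
  shows "tensor_form p (\<lambda>Y. \<Sum>i\<in>I. c i * \<phi> i Y)"
  unfolding tensor_form_def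
proof
  fix Y assume "Y \<in> VF"
  then have "(\<Sum>i\<in>I. c i * \<phi> i Y) = (\<Sum>i\<in>I. c i * (\<Sum>j\<in>UNIV. coord Y j p * \<phi> i (X j)))"
    using assms by (intro sum.cong) (auto simp: tensor_form_def)
  also have "\<dots> = (\<Sum>j\<in>UNIV. coord Y j p * (\<Sum>i\<in>I. c i * \<phi> i (X j)))"
    unfolding sum_distrib_left by (subst sum.swap) (simp add: mult.left_commute)
  finally show "(\<Sum>i\<in>I. c i * \<phi> i Y) = (\<Sum>j\<in>UNIV. coord Y j p * (\<Sum>i\<in>I. c i * \<phi> i (X j)))" .
qed

text \<open>Expanding both arguments in the frame leaves \<open>inverse_gram_contraction\<close>.
  The form \<open>B\<close> is abstract so that it can itself be the result of an inner
  contraction.\<close>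

lemma metric_trace:
  fixes E :: "'n \<Rightarrow> 'm vector_field"
  assumes "\<And>i. E i \<in> VF" "tangent_basis A p (\<lambda>i. E i p)"
    and B: "\<And>Z. Z \<in> VF \<Longrightarrow> tensor_form p (\<lambda>Y. B Y Z)" "\<And>Y. Y \<in> VF \<Longrightarrow> tensor_form p (\<lambda>Z. B Y Z)"
  shows "(\<Sum>i\<in>UNIV. \<Sum>j\<in>UNIV. inverse_gram g E p $ i $ j * B (E i) (E j)) = (\<Sum>a\<in>UNIV. \<eta> a * B (X a) (X a))"
proof -
  let ?G = "inverse_gram g E p"
  have "B (E i) (E j) = (\<Sum>a\<in>UNIV. \<Sum>b\<in>UNIV. coord (E i) a p * coord (E j) b p * B (X a) (X b))" for i j
    using B(1)[OF assms(1)] B(2)[OF VF_X] assms(1)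
    by (simp add: tensor_form_def sum_distrib_left mult.assoc)
  then have "(\<Sum>i\<in>UNIV. \<Sum>j\<in>UNIV. ?G $ i $ j * B (E i) (E j)) =
      (\<Sum>i\<in>UNIV. \<Sum>j\<in>UNIV. \<Sum>a\<in>UNIV. \<Sum>b\<in>UNIV.
        ?G $ i $ j * (coord (E i) a p * coord (E j) b p) * B (X a) (X b))"
    by (simp add: sum_distrib_left mult.assoc)
  also have "\<dots> = (\<Sum>a\<in>UNIV. \<Sum>b\<in>UNIV. \<Sum>i\<in>UNIV. \<Sum>j\<in>UNIV.
        ?G $ i $ j * (coord (E i) a p * coord (E j) b p) * B (X a) (X b))"
    by (rule sum_swap_pairs)
  also have "\<dots> = (\<Sum>a\<in>UNIV. \<Sum>b\<in>UNIV. (if a = b then \<eta> a else 0) * B (X a) (X b))"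
    by (simp only: inverse_gram_contraction[OF assms(1,2)] flip: sum_distrib_right)
  also have "\<dots> = (\<Sum>a\<in>UNIV. \<eta> a * B (X a) (X a))"
    by (simp add: sum_mult_delta)
  finally show ?thesis .
qed

text \<open>Two applications of \<open>metric_trace\<close>: the second arguments of
  \<open>T\<close> are contracted for fixed \<open>i\<close> and \<open>j\<close>, and the result is
  a bilinear form in the first arguments.\<close>

lemma square_norm_trace:
  fixes E :: "'n \<Rightarrow> 'm vector_field"
  assumes VF_E: "\<And>i. E i \<in> VF" and basis: "tangent_basis A p (\<lambda>i. E i p)"
    and T1: "\<And>Z. Z \<in> VF \<Longrightarrow> tensorial A (\<lambda>Y. T Y Z)" and T2: "\<And>Y. Y \<in> VF \<Longrightarrow> tensorial A (T Y)"
    and VF_T: "\<And>Y Z. Y \<in> VF \<Longrightarrow> Z \<in> VF \<Longrightarrow> T Y Z \<in> VF"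
  shows "(\<Sum>i\<in>UNIV. \<Sum>j\<in>UNIV. \<Sum>k\<in>UNIV. \<Sum>l\<in>UNIV.
      inverse_gram g E p $ i $ j * inverse_gram g E p $ k $ l * g p (T (E i) (E k) p) (T (E j) (E l) p)) =
    (\<Sum>a\<in>UNIV. \<Sum>b\<in>UNIV. \<eta> a * (\<eta> b * g p (T (X a) (X b) p) (T (X a) (X b) p)))"
    (is "?lhs = _")
proof -
  let ?G = "inverse_gram g E p"
  have inner: "(\<Sum>k\<in>UNIV. \<Sum>l\<in>UNIV. ?G $ k $ l * g p (T (E i) (E k) p) (T (E j) (E l) p)) =
      (\<Sum>b\<in>UNIV. \<eta> b * g p (T (E i) (X b) p) (T (E j) (X b) p))" for i j
    by (rule metric_trace[OF VF_E basis, where B = "\<lambda>Y Z. g p (T (E i) Y p) (T (E j) Z p)"];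
        rule tensor_form_metric; (rule T2 VF_T VF_tangent VF_E | assumption)+)
  have "?lhs = (\<Sum>i\<in>UNIV. \<Sum>j\<in>UNIV. ?G $ i $ j *
      (\<Sum>b\<in>UNIV. \<eta> b * g p (T (E i) (X b) p) (T (E j) (X b) p)))"
    unfolding inner[symmetric] by (simp add: sum_distrib_left mult.assoc)
  also have "\<dots> = (\<Sum>a\<in>UNIV. \<eta> a * (\<Sum>b\<in>UNIV. \<eta> b * g p (T (X a) (X b) p) (T (X a) (X b) p)))"
    by (rule metric_trace[OF VF_E basis,
          where B = "\<lambda>Y Z. \<Sum>b\<in>UNIV. \<eta> b * g p (T Y (X b) p) (T Z (X b) p)"];
        rule tensor_form_sum; rule tensor_form_metric; (rule T1 VF_T VF_tangent VF_X | assumption)+)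
  finally show ?thesis
    by (simp add: sum_distrib_left)
qed

end

text \<open>The span is taken over the reals, so the brackets have constant coefficients and the
  span becomes a Lie algebra of fields on which the connection is purely algebraic. Cyclic
  invariance together with skewness of the bracket makes the lowered structure constants totally
  skew.\<close>

locale ad_invariant_frame = orthonormal_frame A g X \<eta>
  for A :: "('m::{t2_space, second_countable_topology}, 'e::euclidean_space) atlas"
    and g and X :: "'n::finite \<Rightarrow> 'm vector_field" and \<eta> +
  fixes D :: "'m connection"
  assumes levi_civita: "levi_civita_connection A g D"
    and bracket_X: "lie_bracket (X i) (X j) \<in> span (range X)"
    and ad_invariant:
      "g p (lie_bracket (X i) (X j) p) (X k p) = g p (lie_bracket (X j) (X k) p) (X i p)"
begin

sublocale affine_atlas A D
  by unfold_locales (use levi_civita in \<open>simp add: levi_civita_connection_def\<close>)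

lemma torsion_free: "Y \<in> VF \<Longrightarrow> Z \<in> VF \<Longrightarrow> D Y Z - D Z Y = lie_bracket Y Z"
  using levi_civita by (simp add: levi_civita_connection_def)

lemma metric_compatible:
  "W \<in> VF \<Longrightarrow> Y \<in> VF \<Longrightarrow> Z \<in> VF \<Longrightarrow>
    W p (\<lambda>q. g q (Y q) (Z q)) = g p (D W Y p) (Z p) + g p (Y p) (D W Z p)"
  using levi_civita by (simp add: levi_civita_connection_def)

lemma span_VF: "Y \<in> span (range X) \<Longrightarrow> Y \<in> VF"
  using span_minimal[OF _ subspace_VF, of "range X"] VF_X by blast

lemma span_X_induct [consumes 1, case_names zero add]:
  assumes "Y \<in> span (range X)" and zero: "P 0"
    and add: "\<And>c i Z. Z \<in> span (range X) \<Longrightarrow> P Z \<Longrightarrow> P (c *\<^sub>R X i + Z)"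
  shows "P Y"
proof -
  have "Y \<in> span (range X) \<and> P Y"
    using assms(1)
  proof (induction rule: span_induct_alt)
    case base
    show ?case
      using zero span_zero by blast
  next
    case (step c Y Z)
    then obtain i where "Y = X i" "Z \<in> span (range X)" "P Z"
      by blast
    then show ?case
      by (simp only: add span_add span_scale span_base rangeI simp_thms)
  qed
  then show ?thesis ..
qed

lemma bracket_zero: "Z \<in> VF \<Longrightarrow> lie_bracket 0 Z = 0" "Z \<in> VF \<Longrightarrow> lie_bracket Z 0 = 0"
  using bracket_scaleR_left[of Z Z 0] bracket_scaleR_right[of Z Z 0] by (simp_all only: scaleR_zero_left)

lemma D_zero: "Z \<in> VF \<Longrightarrow> D 0 Z = 0" "Z \<in> VF \<Longrightarrow> D Z 0 = 0"
  using D_scaleR_left[of Z Z 0] D_scaleR_right[of Z Z 0] by (simp_all only: scaleR_zero_left)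

lemma metric_zero_left: "v \<in> tangent_space A p \<Longrightarrow> g p 0 v = 0"
  using metric_scale_left[of v p v 0] by (simp only: scaleR_zero_left mult_zero_left)

lemma bracket_X_right_span:
  assumes "Z \<in> span (range X)"
  shows "lie_bracket (X i) Z \<in> span (range X)"
  using assms
proof (induction rule: span_X_induct)
  case zero
  show ?case
    by (simp only: bracket_zero VF_X span_zero)
next
  case (add c j Z)
  then show ?case
    by (simp only: bracket_add_right bracket_scaleR_right VF_X VF_scaleR span_VF span_add span_scale bracket_X)
qed

lemma bracket_span:
  assumes "Y \<in> span (range X)" "Z \<in> span (range X)"
  shows "lie_bracket Y Z \<in> span (range X)"
  using assms(1)
proof (induction rule: span_X_induct)
  case zero
  show ?case
    by (simp only: bracket_zero span_VF[OF assms(2)] span_zero)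
next
  case (add c i W)
  then show ?case
    by (simp only: bracket_add_left bracket_scaleR_left VF_X VF_scaleR span_VF span_add span_scale
        bracket_X_right_span assms(2))
qed

text \<open>Koszul's formula: the derivatives of the constant functions \<open>g (X i) (X j)\<close> drop out.\<close>

lemma D_frame: "D (X i) (X j) = (1/2) *\<^sub>R lie_bracket (X i) (X j)"
proof
  fix p
  let ?B = "\<lambda>i j k. g p (D (X i) (X j) p) (X k p)" and ?C = "\<lambda>i j k. g p (lie_bracket (X i) (X j) p) (X k p)"
  note [simp] = VF_tangent VF_D VF_X VF_bracket
  have skew: "?B i j k = - ?B i k j" for i j k
    using metric_compatible[OF VF_X VF_X VF_X, of i p j k] VF_apply_zero[OF VF_X, of i p]
    by (simp add: gram metric_sym[of "X j p"])
  have torsion: "?B i j k = ?B j i k + ?C i j k" for i j k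
    using metric_add_left[of "D (X j) (X i) p" p "lie_bracket (X i) (X j) p" "X k p"]
      torsion_free[OF VF_X VF_X, of i j]
    by (simp add: algebra_simps)
  have "?B i j k = g p (((1/2) *\<^sub>R lie_bracket (X i) (X j)) p) (X k p)" for k
  proof -
    \<comment> \<open>Two torsion and two skewness identities leave the difference of
      \<open>?C i j k\<close> and \<open>?C j k i\<close>, which is zero; so \<open>?B\<close> is
      cyclic. One further exchange then gives \<open>2 * ?B i j k = ?C i j k\<close>.\<close>
    have "?B i j k = ?B k i j"
      using skew[of j i k] skew[of k j i] torsion[of i j k] torsion[of j k i] ad_invariant[of p i j k] by simp
    also have "\<dots> = - ?B i j k + ?C i j k"
      using skew[of i k j] torsion[of k i j] ad_invariant[of p k i j] by simp
    finally show ?thesis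
      by (simp add: scaleR_fun_def[of _ "lie_bracket _ _"] metric_scale_left)
  qed
  then show "D (X i) (X j) p = ((1/2) *\<^sub>R lie_bracket (X i) (X j)) p"
    by (intro metric_eqI[where p = p]) (simp_all add: VF_scaleR)
qed

lemma D_X_span:
  assumes "Z \<in> span (range X)"
  shows "D (X i) Z = (1/2) *\<^sub>R lie_bracket (X i) Z"
  using assms
proof (induction rule: span_X_induct)
  case zero
  show ?case
    by (simp only: bracket_zero D_zero VF_X scaleR_zero_right)
next
  case (add c j Z)
  then show ?case
    by (simp only: bracket_add_right bracket_scaleR_right D_add_right D_scaleR_right D_frame
        VF_X VF_scaleR span_VF scaleR_add_right scaleR_left_commute[of c])
qed

lemma D_span:
  assumes "Y \<in> span (range X)" "Z \<in> span (range X)"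
  shows "D Y Z = (1/2) *\<^sub>R lie_bracket Y Z"
  using assms(1)
proof (induction rule: span_X_induct)
  case zero
  show ?case
    by (simp only: bracket_zero D_zero span_VF[OF assms(2)] scaleR_zero_right)
next
  case (add c i W)
  then show ?case
    by (simp only: bracket_add_left bracket_scaleR_left D_add_left D_scaleR_left D_X_span
        VF_X VF_scaleR span_VF assms(2) scaleR_add_right scaleR_left_commute[of c])
qed

text \<open>By Jacobi the two iterated derivatives contribute 1/4 of the double bracket, and the
  term with \<open>lie_bracket U V\<close> subtracts 1/2 of it.\<close>

lemma curvature_span:
  assumes "U \<in> span (range X)" "V \<in> span (range X)" "W \<in> span (range X)"
  shows "curvature D U V W = - (1/4) *\<^sub>R lie_bracket (lie_bracket U V) W"
  using assms assms[THEN span_VF] jacobi[OF assms[THEN span_VF]]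
  by (simp add: curvature_def D_span bracket_span span_scale bracket_scaleR_right VF_bracket)
    (simp add: fun_eq_iff scaleR_field_apply field_simps)

lemma deriv_curvature_span:
  assumes "U \<in> span (range X)" "V \<in> span (range X)" "W \<in> span (range X)" "Z \<in> span (range X)"
  shows "deriv_curvature D U V W Z = 0"
proof -
  \<comment> \<open>Bracketing with \<open>U\<close> is a derivation of the double bracket, by
    Jacobi used twice. Every summand of \<open>deriv_curvature\<close> carries the common factor 1/8
    = 1/2 * 1/4, up to sign.\<close>
  have "lie_bracket U (lie_bracket (lie_bracket V W) Z) =
      lie_bracket (lie_bracket (lie_bracket U V) W) Z + lie_bracket (lie_bracket V (lie_bracket U W)) Z
      + lie_bracket (lie_bracket V W) (lie_bracket U Z)"
    using assms[THEN span_VF] by (simp add: jacobi[of U] VF_bracket bracket_add_left)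
  then show ?thesis
    using assms assms[THEN span_VF]
    by (simp only: deriv_curvature_def curvature_span D_span bracket_span span_scale
        bracket_scaleR_right bracket_scaleR_left VF_bracket VF_scaleR)
      (simp add: fun_eq_iff scaleR_field_apply field_simps)
qed

lemma locally_symmetric: "locally_symmetric A D"
  unfolding locally_symmetric_def
proof safe
  fix W Y Z U assume VF: "W \<in> VF" "Y \<in> VF" "Z \<in> VF" "U \<in> VF"
  have "deriv_curvature D (X i) (X j) (X k) (X l) = 0" for i j k l
    by (simp add: deriv_curvature_span span_base)
  then have "deriv_curvature D (X i) (X j) (X k) U = 0" for i j k
    by (rule tensorial_eq_0[OF deriv_curvature_tensorial(4)[OF VF_X VF_X VF_X VF(4)] _ VF(4)])
  then have "deriv_curvature D (X i) (X j) Z U = 0" for i j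
    by (rule tensorial_eq_0[OF deriv_curvature_tensorial(3)[OF VF_X VF_X VF(3,4)] _ VF(3)])
  then have "deriv_curvature D (X i) Y Z U = 0" for i
    by (rule tensorial_eq_0[OF deriv_curvature_tensorial(2)[OF VF_X VF(2-4)] _ VF(2)])
  then show "deriv_curvature D W Y Z U = 0"
    by (rule tensorial_eq_0[OF deriv_curvature_tensorial(1)[OF VF] _ VF(1)])
qed

text \<open>The first argument is general because the curvature contributes a bracket there,
  \<open>lie_bracket (X b) (X a)\<close>.\<close>

lemma metric_bracket_span:
  assumes "V \<in> span (range X)"
  shows "g p (lie_bracket V (X i) p) (X j p) = g p (V p) (lie_bracket (X i) (X j) p)"
  using assms
proof (induction rule: span_X_induct)
  case zero
  show ?case
    by (simp only: bracket_zero zero_fun_apply[where x = p] metric_zero_left VF_X VF_tangent VF_bracket)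
next
  case (add c k V)
  have *: "(c *\<^sub>R Y + W) p = c *\<^sub>R Y p + W p" for Y W :: "'m vector_field"
    by (simp add: scaleR_fun_def)
  have "g p (lie_bracket (X k) (X i) p) (X j p) = g p (X k p) (lie_bracket (X i) (X j) p)"
    by (simp add: ad_invariant[of p k] metric_sym[of "X k p"] VF_tangent VF_X VF_bracket)
  with add show ?case
    by (simp only: bracket_add_left bracket_scaleR_left * metric_add_left metric_scale_left
        subspace_scale[OF subspace_tangent_space] VF_tangent VF_X VF_bracket VF_scaleR span_VF)
qed

lemma scalar_curvature_frame:
  fixes E :: "'n \<Rightarrow> 'm vector_field"
  assumes VF_E: "\<And>i. E i \<in> VF" and basis: "tangent_basis A p (\<lambda>i. E i p)"
  shows "scalar_curvature g D E p = 1/4 *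
    (\<Sum>a\<in>UNIV. \<Sum>b\<in>UNIV. \<eta> a * (\<eta> b * g p (lie_bracket (X a) (X b) p) (lie_bracket (X a) (X b) p)))"
proof -
  note [simp] = VF_tangent VF_X VF_bracket VF_scaleR
  \<comment> \<open>Exchanging \<open>X a\<close> and \<open>X b\<close> absorbs the sign of the
    curvature formula; ad-invariance then moves the outer bracket to the other side of the
    metric.\<close>
  have sectional: "g p (curvature D (X a) (X b) (X b) p) (X a p) =
      1/4 * g p (lie_bracket (X b) (X a) p) (lie_bracket (X b) (X a) p)" for a b
  proof -
    have "curvature D (X a) (X b) (X b) p = (1/4) *\<^sub>R lie_bracket (lie_bracket (X b) (X a)) (X b) p"
      using bracket_scaleR_left[of "lie_bracket (X b) (X a)" "X b" "- 1"]
      by (simp add: curvature_span span_base bracket_swap[of "X a" "X b"])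
        (simp add: fun_eq_iff scaleR_field_apply scaleR_fun_def)
    then show ?thesis
      by (simp add: metric_scale_left metric_bracket_span bracket_X)
  qed
  have ricci: "ricci g D E Y Z p = (\<Sum>a\<in>UNIV. \<eta> a * g p (curvature D (X a) Y Z p) (X a p))"
    if "Y \<in> VF" "Z \<in> VF" for Y Z
    unfolding ricci_def curvature4_def
  proof (rule metric_trace[OF VF_E basis])
    show "tensor_form p (\<lambda>W. g p (curvature D W Y Z p) (U p))" if "U \<in> VF" for U
      using that \<open>Y \<in> VF\<close> \<open>Z \<in> VF\<close>
      by (intro tensor_form_metric curvature_tensorial1 VF_curvature) simp_all
    show "tensor_form p (\<lambda>U. g p (curvature D W Y Z p) (U p))" if "W \<in> VF" for W
      using that \<open>Y \<in> VF\<close> \<open>Z \<in> VF\<close>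
      by (intro tensor_form_metric(2)) (simp_all add: tensorial_def VF_curvature)
  qed
  have "scalar_curvature g D E p =
      (\<Sum>i\<in>UNIV. \<Sum>j\<in>UNIV. inverse_gram g E p $ i $ j *
        (\<Sum>a\<in>UNIV. \<eta> a * g p (curvature D (X a) (E i) (E j) p) (X a p)))"
    unfolding scalar_curvature_def by (simp add: ricci VF_E)
  also have "\<dots> = (\<Sum>b\<in>UNIV. \<eta> b * (\<Sum>a\<in>UNIV. \<eta> a * g p (curvature D (X a) (X b) (X b) p) (X a p)))"
  proof (rule metric_trace[OF VF_E basis])
    show "tensor_form p (\<lambda>Y. \<Sum>a\<in>UNIV. \<eta> a * g p (curvature D (X a) Y Z p) (X a p))" if "Z \<in> VF" for Z
      using that by (intro tensor_form_sum tensor_form_metric curvature_tensorial2 VF_curvature) simp_all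
    show "tensor_form p (\<lambda>Z. \<Sum>a\<in>UNIV. \<eta> a * g p (curvature D (X a) Y Z p) (X a p))" if "Y \<in> VF" for Y
      using that by (intro tensor_form_sum tensor_form_metric curvature_tensorial3 VF_curvature) simp_all
  qed
  finally show ?thesis
    by (simp add: sectional sum_distrib_left mult_ac)
qed

end

section \<open>The six-dimensional group\<close>

lemma exhaust_6:
  fixes x :: 6
  shows "x = 1 \<or> x = 2 \<or> x = 3 \<or> x = 4 \<or> x = 5 \<or> x = 6"
proof (induct x)
  case (of_int z)
  \<comment> \<open>Arithmetic in this type is modulo 6: the representative 0 is the index
    6.\<close>
  then have "z = 0 \<or> z = 1 \<or> z = 2 \<or> z = 3 \<or> z = 4 \<or> z = 5" by fastforce
  then show ?case by auto
qed

lemma forall_6: "(\<forall>i::6. P i) \<longleftrightarrow> P 1 \<and> P 2 \<and> P 3 \<and> P 4 \<and> P 5 \<and> P 6"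
  by (metis exhaust_6)

lemma sum_6: "sum f (UNIV :: 6 set) = f 1 + f 2 + f 3 + f 4 + f 5 + f 6"
proof -
  have UNIV_6: "UNIV = {1, 2, 3, 4, 5, 6 :: 6}"
    using exhaust_6 by auto
  show ?thesis
    unfolding UNIV_6 by (simp add: add.assoc)
qed

text \<open>A normal form with explicit coefficients: brackets, \<open>J\<close> and the metric turn
  into operations on six-tuples of reals, so the final sums become polynomials in the
  parameters.\<close>

definition comb :: "(6 \<Rightarrow> 'v::real_vector) \<Rightarrow> real \<Rightarrow> real \<Rightarrow> real \<Rightarrow> real \<Rightarrow> real \<Rightarrow> real \<Rightarrow> 'v" where
  "comb X a b c d e f = a *\<^sub>R X 1 + b *\<^sub>R X 2 + c *\<^sub>R X 3 + d *\<^sub>R X 4 + e *\<^sub>R X 5 + f *\<^sub>R X 6"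

lemma comb_arith:
  "comb X a b c d e f + comb X a' b' c' d' e' f' = comb X (a + a') (b + b') (c + c') (d + d') (e + e') (f + f')"
  "comb X a b c d e f - comb X a' b' c' d' e' f' = comb X (a - a') (b - b') (c - c') (d - d') (e - e') (f - f')"
  "- comb X a b c d e f = comb X (- a) (- b) (- c) (- d) (- e) (- f)"
  "r *\<^sub>R comb X a b c d e f = comb X (r * a) (r * b) (r * c) (r * d) (r * e) (r * f)"
  by (simp_all add: comb_def scaleR_add_left scaleR_diff_left scaleR_add_right)

lemma comb_frame:
  "X 1 = comb X 1 0 0 0 0 0" "X 2 = comb X 0 1 0 0 0 0" "X 3 = comb X 0 0 1 0 0 0"
  "X 4 = comb X 0 0 0 1 0 0" "X 5 = comb X 0 0 0 0 1 0" "X 6 = comb X 0 0 0 0 0 1"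
  by (simp_all add: comb_def)

lemma comb_in_span: "comb X a b c d e f \<in> span (range X)"
  unfolding comb_def by (intro span_add span_scale span_base rangeI)

abbreviation sign6 :: "6 \<Rightarrow> real" where
  "sign6 i \<equiv> if i \<in> {1, 2, 3} then 1 else - 1"

lemma (in metric_atlas) metric_comb:
  fixes X :: "6 \<Rightarrow> 'm vector_field"
  assumes "orthonormal_frame A g X sign6"
  shows "g p (comb X a b c d e f p) (comb X a' b' c' d' e' f' p) =
      a * a' + b * b' + c * c' - d * d' - e * e' - f * f'"
proof -
  interpret orthonormal_frame A g X sign6 by (rule assms)
  define u where "u x1 x2 x3 x4 x5 x6 i = (if i = 1 then x1 else if i = 2 then x2 else if i = 3 then x3
      else if i = 4 then x4 else if i = 5 then x5 else (x6 :: real))" for x1 x2 x3 x4 x5 x6 and i :: 6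
  have comb: "comb X x1 x2 x3 x4 x5 x6 p = (\<Sum>i\<in>UNIV. u x1 x2 x3 x4 x5 x6 i *\<^sub>R X i p)"
    for x1 x2 x3 x4 x5 x6
    unfolding comb_def sum_6 by (simp add: u_def scaleR_fun_def)
  show ?thesis
    unfolding comb
    by (simp only: metric_sum_left metric_sum_right tangent_X subspace_sum[OF subspace_tangent_space]
        subspace_scale[OF subspace_tangent_space] gram)
      (simp add: sum_6 u_def)
qed

lemma (in almost_complex_atlas) J_comb:
  fixes X :: "6 \<Rightarrow> 'm vector_field"
  assumes "\<And>i. X i \<in> VF" "\<And>i. i \<in> {1, 2, 3} \<Longrightarrow> JF (X i) = X (3 + i)"
    "\<And>i. i \<in> {1, 2, 3} \<Longrightarrow> JF (X (3 + i)) = - X i"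
  shows "JF (comb X a b c d e f) = comb X (- d) (- e) (- f) a b c"
  using assms(2)[of 1] assms(2)[of 2] assms(2)[of 3] assms(3)[of 1] assms(3)[of 2] assms(3)[of 3]
  by (simp add: comb_def J_add J_scaleR assms(1) VF_add VF_scaleR)

theorem theorem4p4:
  fixes A :: "('m::{t2_space, second_countable_topology}, real^6) atlas"
    and mul :: "'m \<Rightarrow> 'm \<Rightarrow> 'm" and e :: 'm and iv :: "'m \<Rightarrow> 'm"
    and X :: "6 \<Rightarrow> 'm vector_field"
    and l1 l2 l3 l4 l5 l6 :: real
    and J :: "'m endomorphism_field" and g :: "'m metric" and D :: "'m connection"
  assumes G: "lie_group A mul e iv" and conn: "connected (UNIV :: 'm set)"
    and frame: "global_frame A X" and left: "\<And>i. left_invariant_field A mul (X i)"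
    and b23: "lie_bracket (X 2) (X 3) = l1 *\<^sub>R X 5 + l2 *\<^sub>R X 6"
    and b31: "lie_bracket (X 3) (X 1) = l4 *\<^sub>R X 4 + l3 *\<^sub>R X 6"
    and b12: "lie_bracket (X 1) (X 2) = l5 *\<^sub>R X 4 + l6 *\<^sub>R X 5"
    and b56: "lie_bracket (X 5) (X 6) = - l4 *\<^sub>R X 2 - l5 *\<^sub>R X 3"
    and b64: "lie_bracket (X 6) (X 4) = - l1 *\<^sub>R X 1 - l6 *\<^sub>R X 3"
    and b45: "lie_bracket (X 4) (X 5) = - l2 *\<^sub>R X 1 - l3 *\<^sub>R X 2"
    and b15: "lie_bracket (X 1) (X 5) = l6 *\<^sub>R X 2 - l2 *\<^sub>R X 4"
    and b16: "lie_bracket (X 1) (X 6) = - l3 *\<^sub>R X 3 + l1 *\<^sub>R X 4"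
    and b24: "lie_bracket (X 2) (X 4) = - l5 *\<^sub>R X 1 + l3 *\<^sub>R X 5"
    and b26: "lie_bracket (X 2) (X 6) = l2 *\<^sub>R X 3 - l4 *\<^sub>R X 5"
    and b34: "lie_bracket (X 3) (X 4) = l4 *\<^sub>R X 1 - l6 *\<^sub>R X 6"
    and b35: "lie_bracket (X 3) (X 5) = - l1 *\<^sub>R X 2 + l5 *\<^sub>R X 6"
    and b14: "lie_bracket (X 1) (X 4) = l5 *\<^sub>R X 2 - l4 *\<^sub>R X 3 + l2 *\<^sub>R X 5 - l1 *\<^sub>R X 6"
    and b25: "lie_bracket (X 2) (X 5) = - l6 *\<^sub>R X 1 + l1 *\<^sub>R X 3 - l3 *\<^sub>R X 4 + l4 *\<^sub>R X 6"
    and b36: "lie_bracket (X 3) (X 6) = l3 *\<^sub>R X 1 - l2 *\<^sub>R X 2 + l6 *\<^sub>R X 4 - l5 *\<^sub>R X 5"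
    and J: "almost_complex_structure A J" "left_invariant_endomorphism A mul J"
    and JX: "\<And>i. i \<in> {1, 2, 3} \<Longrightarrow> apply_field J (X i) = X (3 + i)"
            "\<And>i. i \<in> {1, 2, 3} \<Longrightarrow> apply_field J (X (3 + i)) = - X i"
    and g: "pseudo_riemannian_metric A g" "left_invariant_metric A mul g"
    and gX: "\<And>i p. i \<in> {1, 2, 3} \<Longrightarrow> g p (X i p) (X i p) = 1"
            "\<And>i p. i \<in> {1, 2, 3} \<Longrightarrow> - g p (X (3 + i) p) (X (3 + i) p) = 1"
            "\<And>j k p. j \<noteq> k \<Longrightarrow> g p (X j p) (X k p) = 0"
    and D: "levi_civita_connection A g D"
  shows "isotropic_kaehlerian A J g D \<and>
         isotropic_nijenhuis A J g \<and>
         scalar_flat A g D \<and>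
         locally_symmetric A D"
proof -
  interpret smooth_atlas A
    using G by unfold_locales (simp add: lie_group_def)
  interpret metric_atlas A g
    using g(1) by unfold_locales
  interpret almost_complex_atlas A J
    using J(1) by unfold_locales
  have gram: "g p (X i p) (X j p) = (if i = j then sign6 i else 0)" for p i j
  proof -
    have "g p (X i p) (X i p) = sign6 i"
      using exhaust_6[of i] gX(1)[of i p] gX(2)[of 1 p] gX(2)[of 2 p] gX(2)[of 3 p] by auto
    then show ?thesis
      using gX(3)[of i j p] by (cases "i = j") auto
  qed
  interpret orthonormal_frame A g X sign6
    by unfold_locales (use frame gram in auto)
  have comb_metric: "g p (comb X a b c d e f p) (comb X a' b' c' d' e' f' p) =
      a * a' + b * b' + c * c' - d * d' - e * e' - f * f'" for p a b c d e f a' b' c' d' e' f'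
    by (rule metric_comb) unfold_locales
  have J_comb: "JF (comb X a b c d e f) = comb X (- d) (- e) (- f) a b c" for a b c d e f
    by (rule J_comb) (fact VF_X JX)+
  note brackets0 = b23 b31 b12 b56 b64 b45 b15 b16 b24 b26 b34 b35 b14 b25 b36
  have brackets:
    "lie_bracket (X 2) (X 3) = comb X 0 0 0 0 l1 l2"
    "lie_bracket (X 3) (X 1) = comb X 0 0 0 l4 0 l3"
    "lie_bracket (X 1) (X 2) = comb X 0 0 0 l5 l6 0"
    "lie_bracket (X 5) (X 6) = comb X 0 (- l4) (- l5) 0 0 0"
    "lie_bracket (X 6) (X 4) = comb X (- l1) 0 (- l6) 0 0 0"
    "lie_bracket (X 4) (X 5) = comb X (- l2) (- l3) 0 0 0 0"
    "lie_bracket (X 1) (X 5) = comb X 0 l6 0 (- l2) 0 0"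
    "lie_bracket (X 1) (X 6) = comb X 0 0 (- l3) l1 0 0"
    "lie_bracket (X 2) (X 4) = comb X (- l5) 0 0 0 l3 0"
    "lie_bracket (X 2) (X 6) = comb X 0 0 l2 0 (- l4) 0"
    "lie_bracket (X 3) (X 4) = comb X l4 0 0 0 0 (- l6)"
    "lie_bracket (X 3) (X 5) = comb X 0 (- l1) 0 0 0 l5"
    "lie_bracket (X 1) (X 4) = comb X 0 l5 (- l4) 0 l2 (- l1)"
    "lie_bracket (X 2) (X 5) = comb X (- l6) 0 l1 (- l3) 0 l4"
    "lie_bracket (X 3) (X 6) = comb X l3 (- l2) 0 l6 (- l5) 0"
    unfolding brackets0 by (simp_all add: comb_def)
  have swap: "lie_bracket Z Y = comb X (- a) (- b) (- c) (- d) (- e) (- f)"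
    if "lie_bracket Y Z = comb X a b c d e f" for Y Z a b c d e f
    unfolding bracket_swap[of Z] that by (rule comb_arith)
  have diag: "lie_bracket (X i) (X i) = comb X 0 0 0 0 0 0" for i
    by (simp add: lie_bracket_def comb_def fun_eq_iff)
  \<comment> \<open>The given brackets, their reversals and the diagonal make up the complete table
    of 36.\<close>
  note br = brackets brackets[THEN swap] diag
  have metric_X: "g p (comb X a b c d e f p) (X 1 p) = a" "g p (comb X a b c d e f p) (X 2 p) = b"
    "g p (comb X a b c d e f p) (X 3 p) = c" "g p (comb X a b c d e f p) (X 4 p) = - d"
    "g p (comb X a b c d e f p) (X 5 p) = - e" "g p (comb X a b c d e f p) (X 6 p) = - f"
    for p a b c d e f
    unfolding comb_frame[of X] comb_metric by simp_all
  have closed: "\<forall>i j. lie_bracket (X i) (X j) \<in> span (range X)"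
    by (simp only: forall_6 br comb_in_span simp_thms)
  \<comment> \<open>Checked on all 216 index triples; pairing with a frame vector reads off one
    coefficient up to sign.\<close>
  have ad: "\<forall>i j k. g p (lie_bracket (X i) (X j) p) (X k p) = g p (lie_bracket (X j) (X k) p) (X i p)" for p
    by (simp only: forall_6 br metric_X) simp
  interpret ad_invariant_frame A g X sign6 D
    using D closed ad by unfold_locales blast+
  interpret affine_almost_complex_atlas A J D
    by unfold_locales
  have JX': "JF (X 1) = X 4" "JF (X 2) = X 5" "JF (X 3) = X 6"
    "JF (X 4) = - X 1" "JF (X 5) = - X 2" "JF (X 6) = - X 3"
    using JX[of 1] JX[of 2] JX[of 3] by simp_all
  have bracket_minus: "lie_bracket (- X i) Y = - lie_bracket (X i) Y"
      "lie_bracket Y (- X i) = - lie_bracket Y (X i)" if "Y \<in> VF" for Y i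
    using bracket_scaleR_left[OF VF_X that, of "- 1" i] bracket_scaleR_right[OF VF_X that, of "- 1" i] by simp_all
  have JX_span: "\<forall>i. JF (X i) \<in> span (range X)"
    by (simp only: forall_6 JX' span_neg span_base rangeI simp_thms)
  have nabla_J: "deriv_endomorphism D J (X i) (X j) =
      (1/2) *\<^sub>R (lie_bracket (X i) (JF (X j)) - JF (lie_bracket (X i) (X j)))" for i j
    using JX_span
    by (simp add: deriv_endomorphism_def D_span span_base J_scaleR VF_X VF_bracket scaleR_diff_right)
  \<comment> \<open>\<open>J\<close> reverses the sign of the metric on frame vectors, so each of
    the two pure squares gives, up to the factor 1/4, minus the sum in \<open>brackets_0\<close>
    below. The mixed term pairs a bracket with \<open>J\<close> in two slots.\<close>
  have nabla_J_0: "(\<Sum>a\<in>UNIV. \<Sum>b\<in>UNIV. sign6 a * (sign6 b *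
      g p (deriv_endomorphism D J (X a) (X b) p) (deriv_endomorphism D J (X a) (X b) p))) = 0" for p
    unfolding nabla_J
    by (simp only: sum_6 JX' bracket_minus VF_X br J_comb comb_arith comb_metric)
      (simp add: algebra_simps)
  have nijenhuis_0: "(\<Sum>a\<in>UNIV. \<Sum>b\<in>UNIV. sign6 a * (sign6 b *
      g p (nijenhuis J (X a) (X b) p) (nijenhuis J (X a) (X b) p))) = 0" for p
    unfolding nijenhuis_def
    by (simp only: sum_6 JX' bracket_minus VF_X VF_minus br J_comb comb_arith comb_metric)
      (simp add: algebra_simps)
  \<comment> \<open>For instance \<open>l1\<close> enters through the triples {2, 3, 5} and {1, 4,
    6}, whose sign products are -1 and 1.\<close>
  have brackets_0: "(\<Sum>a\<in>UNIV. \<Sum>b\<in>UNIV. sign6 a * (sign6 b *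
      g p (lie_bracket (X a) (X b) p) (lie_bracket (X a) (X b) p))) = 0" for p
    by (simp only: sum_6 br comb_metric) (simp add: algebra_simps)
  have "isotropic_kaehlerian A J g D"
    unfolding isotropic_kaehlerian_def nabla_J_square_norm_def basis_fields_at_def
  proof (intro allI impI, elim conjE)
    fix p and E :: "6 \<Rightarrow> 'm vector_field"
    assume "\<forall>i. E i \<in> VF" and basis: "tangent_basis A p (\<lambda>i. E i p)"
    then have VF_E: "E i \<in> VF" for i by simp
    show "(\<Sum>i\<in>UNIV. \<Sum>j\<in>UNIV. \<Sum>k\<in>UNIV. \<Sum>l\<in>UNIV.
        inverse_gram g E p $ i $ j * inverse_gram g E p $ k $ l *
        g p (deriv_endomorphism D J (E i) (E k) p) (deriv_endomorphism D J (E j) (E l) p)) = 0"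
      using square_norm_trace[OF VF_E basis, where T = "deriv_endomorphism D J"] nabla_J_0
        deriv_endomorphism_tensorial1 deriv_endomorphism_tensorial2 VF_deriv_endomorphism
      by simp
  qed
  moreover have "isotropic_nijenhuis A J g"
    unfolding isotropic_nijenhuis_def basis_fields_at_def
  proof (intro allI impI, elim conjE)
    fix p and E :: "6 \<Rightarrow> 'm vector_field"
    assume "\<forall>i. E i \<in> VF" and basis: "tangent_basis A p (\<lambda>i. E i p)"
    then have VF_E: "E i \<in> VF" for i by simp
    \<comment> \<open>The contracted pairs are (i, k) and (j, s); exchanging the two middle sums
      brings them into the order of \<open>square_norm_trace\<close>.\<close>
    have "nijenhuis_square_norm g J E p = (\<Sum>i\<in>UNIV. \<Sum>k\<in>UNIV. \<Sum>j\<in>UNIV. \<Sum>s\<in>UNIV.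
        inverse_gram g E p $ i $ k * inverse_gram g E p $ j $ s *
        g p (nijenhuis J (E i) (E j) p) (nijenhuis J (E k) (E s) p))"
      unfolding nijenhuis_square_norm_def by (intro sum.cong refl sum.swap)
    also have "\<dots> = 0"
      using square_norm_trace[OF VF_E basis, where T = "nijenhuis J"] nijenhuis_0
        nijenhuis_tensorial1 nijenhuis_tensorial2 VF_nijenhuis
      by simp
    finally show "nijenhuis_square_norm g J E p = 0" .
  qed
  moreover have "scalar_flat A g D"
    unfolding scalar_flat_def basis_fields_at_def
    using scalar_curvature_frame brackets_0 by simp
  ultimately show ?thesis
    using locally_symmetric by simp
qed

end
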